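(* There is an $O(m|B|)$ time algorithm that, given an unweighted undirected graph $G=(V,E)$ with $m$ edges and $S\subseteq V$ with $T=V\setminus S$, outputs an estimate $R'$ such that $R_{ST}(G)\leq R'\leq \tfrac{3}{2}R_{ST}(G)+3$.
   Context: $d(u,v)$ denotes the shortest path distance in $G$. For $v\in S$, $\varepsilon_{ST}(v)=\max_{u\in T}d(v,u)$, and $R_{ST}(G)=\min_{v\in S}\varepsilon_{ST}(v)$. Let $S'$ be the set of vertices of $S$ that have a neighbor in $T$, and $T'$ the set of vertices of $T$ that have a neighbor in $S$. The boundary $B$ is whichever of $S'$ and $T'$ is smaller in size.
   Formalization: The O(m|B|) time bound is proved when B is nonempty and G has no isolated vertices; for all other inputs, where that bound cannot hold in general, the same algorithm is shown to run in O(m|B| + n + m + 1) time. *)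

theory Defs
  imports Complex_Main "HOL-Library.Extended_Real"
begin

section \<open>Graphs, distances and the bichromatic radius\<close>

definition simple_graph :: "'a set \<Rightarrow> 'a set set \<Rightarrow> bool" where
  "simple_graph V E \<longleftrightarrow> finite V \<and> (\<forall>e\<in>E. e \<subseteq> V \<and> card e = 2)"

definition is_path :: "'a set set \<Rightarrow> 'a \<Rightarrow> 'a list \<Rightarrow> 'a \<Rightarrow> bool" where
  "is_path E u p v \<longleftrightarrow>
     p \<noteq> [] \<and> hd p = u \<and> last p = v \<and> distinct p \<and> successively (\<lambda>x y. {x, y} \<in> E) p"

text \<open>The distance between vertices in different components is \<open>\<infinity>\<close>.\<close>

definition gdist :: "'a set set \<Rightarrow> 'a \<Rightarrow> 'a \<Rightarrow> enat" where
  "gdist E u v = (INF p\<in>{p. is_path E u p v}. enat (length p - 1))"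

text \<open>
  For finite nonempty \<open>S\<close> and \<open>T\<close> the supremum and infimum below are a maximum and a minimum.
  In the degenerate cases, an eccentricity towards \<open>T = {}\<close> is \<open>0\<close>, and the radius for
  \<open>S = {}\<close> is \<open>\<infinity>\<close>.
\<close>

definition ecc_ST :: "'a set set \<Rightarrow> 'a set \<Rightarrow> 'a \<Rightarrow> enat" where
  "ecc_ST E T v = (SUP u\<in>T. gdist E v u)"

definition radius_ST :: "'a set set \<Rightarrow> 'a set \<Rightarrow> 'a set \<Rightarrow> enat" where
  "radius_ST E S T = (INF v\<in>S. ecc_ST E T v)"

definition with_neighbor_in :: "'a set set \<Rightarrow> 'a set \<Rightarrow> 'a set \<Rightarrow> 'a set" where
  "with_neighbor_in E A C = {v \<in> A. \<exists>u\<in>C. {v, u} \<in> E}"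

definition boundary :: "'a set set \<Rightarrow> 'a set \<Rightarrow> 'a set \<Rightarrow> 'a set" where
  "boundary E S T =
     (let S' = with_neighbor_in E S T; T' = with_neighbor_in E T S
      in if card S' \<le> card T' then S' else T')"


section \<open>A word RAM\<close>

text \<open>
  Algorithms are programs for a random access machine with \<open>w\<close>-bit words. A program is a fixed
  syntactic object that does not depend on \<open>w\<close>. It uses finitely many registers and a memory
  that is addressed by the contents of registers. All arithmetic is modulo \<open>2 ^ w\<close>. Every
  instruction and every evaluation of a test takes one unit of time. Structured control flow
  replaces jumps, which affects running times by a constant factor only.
\<close>

type_synonym reg = nat

datatype test = Less reg reg | Equal reg reg

datatype prog =
    Skip
  | Const reg nat
  | Move reg reg
  | Add reg reg reg
  | Sub reg reg reg
  | Load reg reg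
  | Store reg reg
  | Seq prog prog
  | IfElse test prog prog
  | While test prog

record state =
  regs :: "reg \<Rightarrow> nat"
  mem :: "nat \<Rightarrow> nat"

definition set_reg :: "reg \<Rightarrow> nat \<Rightarrow> state \<Rightarrow> state" where
  "set_reg r x s = s\<lparr>regs := (regs s)(r := x)\<rparr>"

definition set_mem :: "nat \<Rightarrow> nat \<Rightarrow> state \<Rightarrow> state" where
  "set_mem a x s = s\<lparr>mem := (mem s)(a := x)\<rparr>"

fun holds :: "test \<Rightarrow> state \<Rightarrow> bool" where
  "holds (Less i j) s \<longleftrightarrow> regs s i < regs s j"
| "holds (Equal i j) s \<longleftrightarrow> regs s i = regs s j"

text \<open>
  \<open>exec w P s t s'\<close>: on word length \<open>w\<close>, program \<open>P\<close> started in state \<open>s\<close> halts in state \<open>s'\<close>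
  after exactly \<open>t\<close> units of time.
\<close>

inductive exec :: "nat \<Rightarrow> prog \<Rightarrow> state \<Rightarrow> nat \<Rightarrow> state \<Rightarrow> bool" for w :: nat where
  exec_Skip: "exec w Skip s 1 s"
| exec_Const: "exec w (Const r k) s 1 (set_reg r (k mod 2 ^ w) s)"
| exec_Move: "exec w (Move r i) s 1 (set_reg r (regs s i) s)"
| exec_Add: "exec w (Add r i j) s 1 (set_reg r ((regs s i + regs s j) mod 2 ^ w) s)"
| exec_Sub: "exec w (Sub r i j) s 1
    (set_reg r (nat ((int (regs s i) - int (regs s j)) mod 2 ^ w)) s)"
| exec_Load: "exec w (Load r i) s 1 (set_reg r (mem s (regs s i)) s)"
| exec_Store: "exec w (Store i r) s 1 (set_mem (regs s i) (regs s r) s)"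
| exec_Seq: "exec w P s t s' \<Longrightarrow> exec w Q s' u s'' \<Longrightarrow> exec w (Seq P Q) s (t + u) s''"
| exec_IfElse_True: "holds b s \<Longrightarrow> exec w P s t s' \<Longrightarrow> exec w (IfElse b P Q) s (Suc t) s'"
| exec_IfElse_False: "\<not> holds b s \<Longrightarrow> exec w Q s t s' \<Longrightarrow> exec w (IfElse b P Q) s (Suc t) s'"
| exec_While_False: "\<not> holds b s \<Longrightarrow> exec w (While b P) s 1 s"
| exec_While_True: "holds b s \<Longrightarrow> exec w P s t s' \<Longrightarrow> exec w (While b P) s' u s'' \<Longrightarrow>
    exec w (While b P) s (Suc (t + u)) s''"

inductive_cases exec_elims:
  "exec w Skip s t s'"
  "exec w (Const r k) s t s'"
  "exec w (Move r i) s t s'"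
  "exec w (Add r i j) s t s'"
  "exec w (Sub r i j) s t s'"
  "exec w (Load r i) s t s'"
  "exec w (Store i r) s t s'"
  "exec w (Seq P Q) s t s'"
  "exec w (IfElse b P Q) s t s'"

inductive_cases exec_WhileE: "exec w (While b P) s t s'"

lemma exec_deterministic:
  "exec w P s t s' \<Longrightarrow> exec w P s u s'' \<Longrightarrow> u = t \<and> s'' = s'"
proof (induction arbitrary: u s'' rule: exec.induct)
  case (exec_Seq P s t s' Q v s2)
  from exec_Seq.prems obtain t1 s1 v1
    where "exec w P s t1 s1" "exec w Q s1 v1 s''" "u = t1 + v1"
    by (rule exec_elims)
  with exec_Seq.IH show ?case by blast
next
  case (exec_IfElse_True b s P t s' Q)
  from exec_IfElse_True.prems exec_IfElse_True.hyps(1)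
  obtain t1 where "exec w P s t1 s''" "u = Suc t1"
    by (auto elim: exec_elims)
  with exec_IfElse_True.IH show ?case by blast
next
  case (exec_IfElse_False b s Q t s' P)
  from exec_IfElse_False.prems exec_IfElse_False.hyps(1)
  obtain t1 where "exec w Q s t1 s''" "u = Suc t1"
    by (auto elim: exec_elims)
  with exec_IfElse_False.IH show ?case by blast
next
  case (exec_While_False b s P)
  from exec_While_False.prems exec_While_False.hyps show ?case
    by (auto elim: exec_WhileE)
next
  case (exec_While_True b s P t s' v s2)
  from exec_While_True.prems exec_While_True.hyps(1)
  obtain t1 s1 v1 where "exec w P s t1 s1" "exec w (While b P) s1 v1 s''" "u = Suc (t1 + v1)"
    by (auto elim: exec_WhileE)
  with exec_While_True.IH show ?case by blast
qed (auto elim: exec_elims)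


section \<open>Input and output conventions\<close>

text \<open>
  The vertices are \<open>0, \<dots>, n - 1\<close>, and the graph is given by adjacency lists whose entries appear
  in an arbitrary order.
\<close>

definition adjacency_lists :: "nat \<Rightarrow> nat set set \<Rightarrow> nat list list \<Rightarrow> bool" where
  "adjacency_lists n E adj \<longleftrightarrow>
     length adj = n \<and> (\<forall>v<n. distinct (adj ! v) \<and> set (adj ! v) = {u. {v, u} \<in> E})"

text \<open>
  The memory initially holds \<open>n\<close>, followed by the characteristic vector of \<open>S\<close> (\<open>n\<close> words), the
  start positions of the adjacency lists within their concatenation, including the final end
  position (\<open>n + 1\<close> words), and this concatenation (\<open>2 * m\<close> words for \<open>m\<close> edges). All other
  memory cells and all registers are \<open>0\<close>.
\<close>

definition input_words :: "nat \<Rightarrow> nat set \<Rightarrow> nat list list \<Rightarrow> nat list" where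
  "input_words n S adj =
     [n] @ map (\<lambda>v. if v \<in> S then 1 else 0) [0..<n]
         @ map (\<lambda>v. length (concat (take v adj))) [0..<Suc n]
         @ concat adj"

definition initial_state :: "nat list \<Rightarrow> state" where
  "initial_state xs = \<lparr>regs = (\<lambda>_. 0), mem = (\<lambda>a. if a < length xs then xs ! a else 0)\<rparr>"

text \<open>The result is read off register 0, unless register 1 signals that it is infinite.\<close>

definition result :: "state \<Rightarrow> enat" where
  "result s = (if regs s 1 = 0 then enat (regs s 0) else \<infinity>)"

end

theory Submission
  imports Defs
begin

text \<open>
  A shortest path from \<open>S\<close> to \<open>T\<close> meets the boundary \<open>B\<close>. Let \<open>s\<close> be an optimal center and \<open>R\<close> the
  radius. If some \<open>b \<in> B\<close> has distance at most \<open>R / 2\<close> from \<open>s\<close>, then the eccentricity of \<open>b\<close> is at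
  most \<open>3 / 2 * R\<close>, and \<open>b\<close> or a neighbor of \<open>b\<close> lies in \<open>S\<close>. Otherwise every vertex of \<open>T\<close> is at
  distance less than \<open>R / 2\<close> from \<open>B\<close>, while \<open>s\<close> has distance at most \<open>R + 1\<close> to all of \<open>B\<close>; hence a
  vertex of \<open>S\<close> with the smallest maximal distance to \<open>B\<close> has eccentricity at most \<open>3 / 2 * R + 1\<close>.
  Breadth-first searches from the vertices of \<open>B\<close> yield both bounds. Visited vertices are
  stamped with the source of the search, and all distances are aggregated when a vertex leaves
  the queue, so that a search needs neither an initialization nor a final pass over the
  vertices: it takes time \<open>O(m)\<close>, even if there are many isolated vertices.
\<close>

section \<open>Distances and the estimate\<close>

lemma enat_Inf_mem: "A \<noteq> {} \<Longrightarrow> Inf A \<in> (A :: enat set)"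
  unfolding Inf_enat_def using LeastI_ex[of "\<lambda>x. x \<in> A"] by auto

lemma enat_INF_attained:
  fixes f :: "'a \<Rightarrow> enat"
  assumes "B \<noteq> {}"
  shows "\<exists>b\<in>B. (INF b\<in>B. f b) = f b"
  using enat_Inf_mem[of "f ` B"] assms by auto

lemma gdist_le_iff:
  "gdist E u v \<le> enat k \<longleftrightarrow> (\<exists>p. is_path E u p v \<and> length p \<le> Suc k)"
proof
  assume le: "gdist E u v \<le> enat k"
  have "{p. is_path E u p v} \<noteq> {}"
  proof
    assume "{p. is_path E u p v} = {}"
    then have "gdist E u v = \<infinity>" unfolding gdist_def by (simp only: image_empty) (simp add: top_enat_def)
    with le show False by simp
  qed
  then obtain p where "is_path E u p v" "gdist E u v = enat (length p - 1)"
    unfolding gdist_def using enat_INF_attained[of "{p. is_path E u p v}"] by blast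
  with le show "\<exists>p. is_path E u p v \<and> length p \<le> Suc k"
    by (auto intro!: exI[of _ p])
next
  assume "\<exists>p. is_path E u p v \<and> length p \<le> Suc k"
  then obtain p where p: "is_path E u p v" "length p \<le> Suc k" by blast
  then have "gdist E u v \<le> enat (length p - 1)"
    unfolding gdist_def by (intro INF_lower) auto
  also have "\<dots> \<le> enat k" using p(2) by simp
  finally show "gdist E u v \<le> enat k" .
qed

definition is_walk :: "'a set set \<Rightarrow> 'a \<Rightarrow> 'a list \<Rightarrow> 'a \<Rightarrow> bool" where
  "is_walk E u p v \<longleftrightarrow>
     p \<noteq> [] \<and> hd p = u \<and> last p = v \<and> successively (\<lambda>x y. {x, y} \<in> E) p"

lemma is_walk_imp_path:
  "is_walk E u p v \<Longrightarrow> \<exists>q. is_path E u q v \<and> length q \<le> length p"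
proof (induction "length p" arbitrary: p rule: less_induct)
  case less
  show ?case
  proof (cases "distinct p")
    case True
    with less.prems show ?thesis by (auto simp: is_walk_def is_path_def)
  next
    case False
    then obtain xs ys zs y where p: "p = xs @ [y] @ ys @ [y] @ zs"
      using not_distinct_decomp by blast
    have "is_walk E u (xs @ [y] @ zs) v"
      using less.prems unfolding p is_walk_def
      by (auto simp: successively_append_iff successively_Cons hd_append split: if_splits)
    with less.hyps[of "xs @ [y] @ zs"] p show ?thesis by fastforce
  qed
qed

lemma gdist_le_walk_iff:
  "gdist E u v \<le> enat k \<longleftrightarrow> (\<exists>p. is_walk E u p v \<and> length p \<le> Suc k)"
proof -
  have "is_walk E u p v" if "is_path E u p v" for p
    using that by (simp add: is_path_def is_walk_def)
  then show ?thesis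
    unfolding gdist_le_iff using is_walk_imp_path[of E u _ v] by (meson order_trans)
qed

lemma enat_le_all_iff: "(x::enat) \<le> y \<longleftrightarrow> (\<forall>k. y \<le> enat k \<longrightarrow> x \<le> enat k)"
proof
  assume all: "\<forall>k. y \<le> enat k \<longrightarrow> x \<le> enat k"
  show "x \<le> y"
  proof (cases y)
    case (enat k)
    then show ?thesis using all by simp
  qed simp
next
  assume "x \<le> y"
  then show "\<forall>k. y \<le> enat k \<longrightarrow> x \<le> enat k"
    by (intro allI impI) (rule order_trans)
qed

lemma gdist_commute: "gdist E u v = gdist E v u"
proof -
  have "gdist E v u \<le> gdist E u v" for u v
    unfolding enat_le_all_iff[of "gdist E v u"] gdist_le_walk_iff
  proof (intro allI impI, elim exE conjE)
    fix k p assume p: "is_walk E u p v" "length p \<le> Suc k"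
    then have "is_walk E v (rev p) u"
      by (simp add: is_walk_def hd_rev last_rev insert_commute)
    with p(2) show "\<exists>q. is_walk E v q u \<and> length q \<le> Suc k"
      by (metis length_rev)
  qed
  then show ?thesis by (simp add: antisym)
qed

lemma gdist_le_0_iff: "gdist E u v \<le> 0 \<longleftrightarrow> u = v"
proof -
  have "gdist E u v \<le> enat 0 \<longleftrightarrow> u = v"
    unfolding gdist_le_walk_iff is_walk_def
    by (auto simp: Suc_le_eq length_Suc_conv le_Suc_eq intro!: exI[of _ "[u]"])
  then show ?thesis by (simp add: zero_enat_def)
qed

lemma gdist_self: "gdist E u u = 0"
  using gdist_le_0_iff[of E u u] by simp

lemma gdist_triangle: "gdist E u w \<le> gdist E u v + gdist E v w"
proof (cases "gdist E u v"; cases "gdist E v w")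
  fix i j assume i: "gdist E u v = enat i" and j: "gdist E v w = enat j"
  obtain p where p: "is_walk E u p v" "length p \<le> Suc i"
    using i gdist_le_walk_iff[of E u v i] by auto
  obtain q where q: "is_walk E v q w" "length q \<le> Suc j"
    using j gdist_le_walk_iff[of E v w j] by auto
  have "is_walk E u (p @ tl q) w"
    using p(1) q(1) unfolding is_walk_def
    by (cases q) (auto simp: successively_append_iff successively_Cons)
  moreover have "length (p @ tl q) \<le> Suc (i + j)" using p q by auto
  ultimately have "gdist E u w \<le> enat (i + j)" unfolding gdist_le_walk_iff by blast
  then show ?thesis by (simp add: i j)
qed auto

lemma gdist_triangle_le:
  "gdist E u v \<le> a \<Longrightarrow> gdist E v w \<le> b \<Longrightarrow> gdist E u w \<le> a + b"
  by (rule order_trans[OF gdist_triangle add_mono])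

lemma gdist_le_Suc_iff:
  "gdist E u v \<le> enat (Suc k) \<longleftrightarrow>
     gdist E u v \<le> enat k \<or> (\<exists>x. gdist E u x \<le> enat k \<and> {x, v} \<in> E)"
proof
  assume "gdist E u v \<le> enat (Suc k)"
  then obtain p where p: "is_walk E u p v" "length p \<le> Suc (Suc k)"
    unfolding gdist_le_walk_iff by blast
  show "gdist E u v \<le> enat k \<or> (\<exists>x. gdist E u x \<le> enat k \<and> {x, v} \<in> E)"
  proof (cases "length p \<le> Suc k")
    case True
    with p show ?thesis unfolding gdist_le_walk_iff by blast
  next
    case False
    with p obtain q where q: "p = q @ [v]" unfolding is_walk_def
      by (metis append_butlast_last_id)
    with False have "q \<noteq> []" by auto
    with p(1)[unfolded q] p(2)[unfolded q]
    have "is_walk E u q (last q)" "{last q, v} \<in> E" "length q \<le> Suc k"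
      unfolding is_walk_def by (auto simp: successively_append_iff)
    then show ?thesis unfolding gdist_le_walk_iff by blast
  qed
next
  assume "gdist E u v \<le> enat k \<or> (\<exists>x. gdist E u x \<le> enat k \<and> {x, v} \<in> E)"
  then show "gdist E u v \<le> enat (Suc k)"
  proof
    assume "gdist E u v \<le> enat k"
    also have "enat k \<le> enat (Suc k)" by simp
    finally show ?thesis .
  next
    assume "\<exists>x. gdist E u x \<le> enat k \<and> {x, v} \<in> E"
    then obtain x p where p: "is_walk E u p x" "length p \<le> Suc k" "{x, v} \<in> E"
      unfolding gdist_le_walk_iff by blast
    from p have "is_walk E u (p @ [v]) v" unfolding is_walk_def
      by (auto simp: successively_append_iff)
    with p(2) show ?thesis unfolding gdist_le_walk_iff by force
  qed
qed

lemma gdist_adjacent: "{u, v} \<in> E \<Longrightarrow> gdist E u v \<le> 1"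
  using gdist_le_Suc_iff[of E u v 0] gdist_self[of E u] unfolding one_enat_def
  by (metis One_nat_def order_refl zero_enat_def)

lemma gdist_less_card:
  assumes "simple_graph V E" "u \<in> V" "gdist E u v \<noteq> \<infinity>"
  shows "gdist E u v < enat (card V)"
proof -
  obtain k where k: "gdist E u v = enat k" using assms(3) by auto
  obtain p where p: "is_path E u p v" "length p \<le> Suc k"
    using k gdist_le_iff[of E u v k] by auto
  have "set p \<subseteq> V"
  proof
    fix x assume "x \<in> set p"
    then obtain i where i: "i < length p" "p ! i = x" by (auto simp: in_set_conv_nth)
    show "x \<in> V"
    proof (cases i)
      case 0
      with i p(1) assms(2) show ?thesis by (auto simp: is_path_def hd_conv_nth)
    next
      case (Suc j)
      with p(1) i have "{p ! j, x} \<in> E"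
        unfolding is_path_def successively_conv_nth by auto
      with assms(1) show ?thesis by (auto simp: simple_graph_def)
    qed
  qed
  moreover have "finite V" using assms(1) by (simp add: simple_graph_def)
  ultimately have "card (set p) \<le> card V" by (simp add: card_mono)
  moreover have "card (set p) = length p" "p \<noteq> []"
    using p(1) by (auto simp: is_path_def distinct_card)
  ultimately have len: "length p \<le> card V" "0 < length p" by auto
  have "gdist E u v \<le> enat (length p - 1)"
    unfolding gdist_le_iff using p(1) len by auto
  also have "\<dots> < enat (card V)" using len by (cases "length p") auto
  finally show ?thesis .
qed

lemma walk_crosses:
  assumes "is_walk E s p t" "s \<in> S" "t \<notin> S"
  shows "\<exists>x y. {x, y} \<in> E \<and> x \<in> S \<and> y \<notin> S \<and> y \<in> set p \<and>
    gdist E s x + 1 + gdist E y t \<le> enat (length p - 1)"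
  using assms
proof (induction p arbitrary: s)
  case Nil
  then show ?case by (simp add: is_walk_def)
next
  case (Cons a p)
  then have a: "a = s" and p: "p \<noteq> []" by (auto simp: is_walk_def)
  define y where "y = hd p"
  have e: "{s, y} \<in> E" and wk: "is_walk E y p t"
    using Cons.prems p unfolding is_walk_def y_def by (auto simp: successively_Cons)
  show ?case
  proof (cases "y \<in> S")
    case True
    from Cons.IH[OF wk True] Cons.prems obtain x z where xz:
      "{x, z} \<in> E" "x \<in> S" "z \<notin> S" "z \<in> set p"
      "gdist E y x + 1 + gdist E z t \<le> enat (length p - 1)" by blast
    have "gdist E s x \<le> 1 + gdist E y x"
      by (rule gdist_triangle_le[OF gdist_adjacent[OF e] order_refl])
    then have "gdist E s x + 1 + gdist E z t \<le> 1 + (gdist E y x + 1 + gdist E z t)"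
      by (metis (no_types, lifting) add.assoc add_right_mono)
    also have "\<dots> \<le> 1 + enat (length p - 1)" using xz by (intro add_mono) auto
    also have "\<dots> = enat (length (a # p) - 1)" using p by (cases p) (auto simp: one_enat_def)
    finally show ?thesis using xz by auto
  next
    case False
    have "gdist E y t \<le> enat (length p - 1)"
      unfolding gdist_le_walk_iff using wk by auto
    then have "gdist E s s + 1 + gdist E y t \<le> 1 + enat (length p - 1)"
      by (simp add: gdist_self)
    also have "\<dots> = enat (length (a # p) - 1)" using p by (cases p) (auto simp: one_enat_def)
    finally have "gdist E s s + 1 + gdist E y t \<le> enat (length (a # p) - 1)" .
    moreover have "y \<in> set (a # p)" using p by (simp add: y_def)
    ultimately show ?thesis using e Cons.prems(2) False by blast
  qed
qed

definition estimate :: "'a set set \<Rightarrow> 'a set \<Rightarrow> 'a set \<Rightarrow> 'a set \<Rightarrow> enat" where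
  "estimate E S T B = min ((INF b\<in>B. ecc_ST E T b) + 1)
     ((INF v\<in>S. SUP b\<in>B. gdist E b v) + (SUP t\<in>T. INF b\<in>B. gdist E b t))"

lemma radius_le_estimate:
  assumes "B \<subseteq> with_neighbor_in E S T \<or> B \<subseteq> with_neighbor_in E T S"
  shows "radius_ST E S T \<le> estimate E S T B"
  unfolding estimate_def
proof (rule min.boundedI)
  show "radius_ST E S T \<le> (INF b\<in>B. ecc_ST E T b) + 1"
  proof (cases "B = {}")
    case False
    then obtain b where b: "b \<in> B" "(INF b\<in>B. ecc_ST E T b) = ecc_ST E T b"
      using enat_INF_attained[of B "ecc_ST E T"] by blast
    obtain v where v: "v \<in> S" "gdist E v b \<le> 1"
    proof (cases "b \<in> S")
      case True
      show ?thesis by (rule that[OF True]) (simp add: gdist_self)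
    next
      case False
      with b(1) assms obtain v where v: "v \<in> S" "{b, v} \<in> E"
        unfolding with_neighbor_in_def by blast
      show ?thesis
        by (rule that[OF v(1) gdist_adjacent]) (simp add: v(2) insert_commute[of v b])
    qed
    have "ecc_ST E T v \<le> ecc_ST E T b + 1"
      unfolding ecc_ST_def
    proof (rule SUP_least)
      fix t assume "t \<in> T"
      then have "gdist E b t \<le> (SUP u\<in>T. gdist E b u)" by (rule SUP_upper)
      with v(2) show "gdist E v t \<le> (SUP u\<in>T. gdist E b u) + 1"
        by (subst add.commute) (rule gdist_triangle_le)
    qed
    moreover have "radius_ST E S T \<le> ecc_ST E T v"
      unfolding radius_ST_def using v by (intro INF_lower)
    ultimately show ?thesis using b by simp
  qed (simp add: top_enat_def)
next
  let ?far = "SUP t\<in>T. INF b\<in>B. gdist E b t"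
  show "radius_ST E S T \<le> (INF v\<in>S. SUP b\<in>B. gdist E b v) + ?far"
  proof (cases "S = {}")
    case False
    then obtain v where v: "v \<in> S"
      "(INF v\<in>S. SUP b\<in>B. gdist E b v) = (SUP b\<in>B. gdist E b v)"
      using enat_INF_attained[of S "\<lambda>v. SUP b\<in>B. gdist E b v"] by blast
    have "ecc_ST E T v \<le> (SUP b\<in>B. gdist E b v) + ?far"
      unfolding ecc_ST_def
    proof (rule SUP_least)
      fix t assume t: "t \<in> T"
      have near: "(INF b\<in>B. gdist E b t) \<le> ?far" using t by (rule SUP_upper)
      show "gdist E v t \<le> (SUP b\<in>B. gdist E b v) + ?far"
      proof (cases "B = {}")
        case True
        with near show ?thesis by (simp add: top_enat_def)
      next
        case False
        then obtain b where b: "b \<in> B" "(INF b\<in>B. gdist E b t) = gdist E b t"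
          using enat_INF_attained[of B "\<lambda>b. gdist E b t"] by blast
        have "gdist E v t \<le> gdist E b v + gdist E b t"
          by (rule gdist_triangle_le[OF eq_refl[OF gdist_commute] order_refl])
        also have "\<dots> \<le> (SUP b\<in>B. gdist E b v) + ?far"
          using near b by (intro add_mono SUP_upper) auto
        finally show ?thesis .
      qed
    qed
    moreover have "radius_ST E S T \<le> ecc_ST E T v"
      unfolding radius_ST_def using v by (intro INF_lower)
    ultimately show ?thesis using v by simp
  qed (simp add: top_enat_def)
qed

lemma path_meets_boundary:
  assumes "s \<in> S" "t \<in> T" "S \<inter> T = {}" "\<Union>E \<subseteq> S \<union> T"
    and B: "B = with_neighbor_in E S T \<or> B = with_neighbor_in E T S"
    and k: "gdist E s t \<le> enat k"
  shows "\<exists>b\<in>B. gdist E b s + gdist E b t \<le> enat k"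
proof -
  obtain p where p: "is_walk E s p t" "length p \<le> Suc k"
    using k unfolding gdist_le_walk_iff by blast
  have "t \<notin> S" using assms by blast
  from walk_crosses[OF p(1) assms(1) this] obtain x y where
    xy: "{x, y} \<in> E" "x \<in> S" "y \<notin> S"
      "gdist E s x + 1 + gdist E y t \<le> enat (length p - 1)" by blast
  have "enat (length p - 1) \<le> enat k" using p by simp
  with xy have le: "gdist E s x + 1 + gdist E y t \<le> enat k" by (meson order_trans)
  have yT: "y \<in> T" using xy assms(4) by blast
  have adj: "gdist E x y \<le> 1" by (rule gdist_adjacent) (fact xy)
  show ?thesis
  proof (cases "B = with_neighbor_in E S T")
    case True
    have "gdist E x t \<le> 1 + gdist E y t"
      by (rule gdist_triangle_le[OF adj order_refl])
    then have "gdist E x s + gdist E x t \<le> gdist E s x + 1 + gdist E y t"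
      by (simp add: gdist_commute[of E x s] add.assoc add_left_mono)
    with le True xy yT show ?thesis
      by (intro bexI[of _ x]) (auto simp: with_neighbor_in_def)
  next
    case False
    have "gdist E s y \<le> gdist E s x + 1"
      by (rule gdist_triangle_le[OF order_refl adj])
    then have "gdist E y s + gdist E y t \<le> gdist E s x + 1 + gdist E y t"
      by (simp add: gdist_commute[of E y s] add_right_mono)
    from this le have "gdist E y s + gdist E y t \<le> enat k" by (rule order_trans)
    moreover have "y \<in> B"
      using False B xy(1,2) yT by (simp add: with_neighbor_in_def) (metis insert_commute)
    ultimately show ?thesis by blast
  qed
qed

lemma estimate_le_radius:
  assumes "S \<inter> T = {}" "\<Union>E \<subseteq> S \<union> T"
    and B: "B = with_neighbor_in E S T \<or> B = with_neighbor_in E T S"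
    and R: "radius_ST E S T = enat r"
  shows "\<exists>k. estimate E S T B \<le> enat k \<and> 2 * k \<le> 3 * r + 2"
proof -
  have "S \<noteq> {}" using R by (auto simp: radius_ST_def top_enat_def)
  then obtain s where s: "s \<in> S" "(INF v\<in>S. ecc_ST E T v) = ecc_ST E T s"
    using enat_INF_attained[of S "ecc_ST E T"] by blast
  from s(2) R have es: "ecc_ST E T s = enat r" by (simp add: radius_ST_def)
  have st: "gdist E s t \<le> enat r" if "t \<in> T" for t
    using SUP_upper[OF that, of "gdist E s"] es unfolding ecc_ST_def by simp
  have sb: "gdist E b s \<le> enat (r + 1)" if b: "b \<in> B" for b
  proof -
    obtain t where t: "t \<in> T" "gdist E t b \<le> 1"
    proof (cases "b \<in> T")
      case True
      show ?thesis by (rule that[OF True]) (simp add: gdist_self)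
    next
      case False
      with b B obtain t where t: "t \<in> T" "{b, t} \<in> E"
        unfolding with_neighbor_in_def by blast
      show ?thesis
        by (rule that[OF t(1) gdist_adjacent]) (simp add: t(2) insert_commute[of t b])
    qed
    have "gdist E s b \<le> enat r + 1"
      by (rule gdist_triangle_le[OF st[OF t(1)] t(2)])
    then show ?thesis by (simp add: gdist_commute one_enat_def)
  qed
  show ?thesis
  proof (cases "\<exists>b\<in>B. \<exists>j. gdist E b s = enat j \<and> 2 * j \<le> r")
    case True
    then obtain b j where b: "b \<in> B" "gdist E b s = enat j" "2 * j \<le> r" by blast
    have "ecc_ST E T b \<le> enat (j + r)" unfolding ecc_ST_def
    proof (rule SUP_least)
      fix t assume "t \<in> T"
      with gdist_triangle_le[of E b s "enat j" t "enat r"] st[of t] b(2)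
      show "gdist E b t \<le> enat (j + r)" by simp
    qed
    then have "(INF b\<in>B. ecc_ST E T b) + 1 \<le> enat (j + r) + 1"
      by (intro add_right_mono INF_lower2[OF b(1)])
    then have "estimate E S T B \<le> enat (j + r + 1)"
      unfolding estimate_def by (simp add: one_enat_def min.coboundedI1)
    with b(3) show ?thesis by (intro exI[of _ "j + r + 1"]) auto
  next
    case False
    have near: "(INF b\<in>B. gdist E b t) \<le> enat (r div 2)" if t: "t \<in> T" for t
    proof -
      obtain b where b: "b \<in> B" "gdist E b s + gdist E b t \<le> enat r"
        using path_meets_boundary[OF s(1) t assms(1,2) B st[OF t]] by blast
      then obtain i j where ij: "gdist E b s = enat i" "gdist E b t = enat j" "i + j \<le> r"
        by (cases "gdist E b s"; cases "gdist E b t") auto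
      with False b(1) have "j \<le> r div 2" by force
      with ij b(1) show ?thesis by (auto intro!: INF_lower2)
    qed
    have "(INF v\<in>S. SUP b\<in>B. gdist E b v) \<le> enat (r + 1)"
      using sb by (intro INF_lower2[OF s(1)] SUP_least)
    moreover have "(SUP t\<in>T. INF b\<in>B. gdist E b t) \<le> enat (r div 2)"
      using near by (rule SUP_least)
    ultimately have "(INF v\<in>S. SUP b\<in>B. gdist E b v) + (SUP t\<in>T. INF b\<in>B. gdist E b t)
        \<le> enat (r + 1) + enat (r div 2)"
      by (rule add_mono)
    then have "estimate E S T B \<le> enat (r + 1 + r div 2)"
      unfolding estimate_def by (simp add: min.coboundedI2)
    then show ?thesis by (intro exI[of _ "r + 1 + r div 2"]) auto
  qed
qed

lemma estimate_approximates:
  assumes "S \<inter> T = {}" "\<Union>E \<subseteq> S \<union> T"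
    and B: "B = with_neighbor_in E S T \<or> B = with_neighbor_in E T S"
  shows "ereal_of_enat (estimate E S T B) \<le> 3 / 2 * ereal_of_enat (radius_ST E S T) + 3"
proof -
  have half: "(3 / 2 :: ereal) = ereal (3 / 2)" by (simp add: numeral_eq_ereal)
  show ?thesis
  proof (cases "radius_ST E S T")
    case (enat r)
    from estimate_le_radius[OF assms this] obtain k where
      k: "estimate E S T B \<le> enat k" "2 * k \<le> 3 * r + 2" by blast
    have "ereal_of_enat (estimate E S T B) \<le> ereal (real k)"
      using k(1) ereal_of_enat_le_iff[of _ "enat k"] by simp
    also have "\<dots> \<le> ereal (3 / 2 * real r + 3)"
      using k(2) by simp
    also have "\<dots> = 3 / 2 * ereal_of_enat (radius_ST E S T) + 3"
      unfolding half by (simp add: enat numeral_eq_ereal)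
    finally show ?thesis .
  next
    case infinity
    then show ?thesis unfolding half by simp
  qed
qed

section \<open>Programs with arrays and time credits\<close>

datatype array = Flag | Off | Nbr | Stamp | Queue | Mark | Far | Near | Count

primrec ptr :: "array \<Rightarrow> reg" where
  "ptr Flag = 31" | "ptr Off = 32" | "ptr Nbr = 33" | "ptr Stamp = 34" | "ptr Queue = 35"
| "ptr Mark = 36" | "ptr Far = 37" | "ptr Near = 38" | "ptr Count = 39"

abbreviation tmp :: reg where "tmp \<equiv> 30"

notation Seq (infixr ";;" 60)

definition Read :: "reg \<Rightarrow> array \<Rightarrow> reg \<Rightarrow> prog" where
  "Read r a i = Add tmp (ptr a) i ;; Load r tmp"

definition Write :: "array \<Rightarrow> reg \<Rightarrow> reg \<Rightarrow> prog" where
  "Write a i r = Add tmp (ptr a) i ;; Store tmp r"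

lemma ptr_ge: "30 < ptr a"
  by (cases a) simp_all

locale word_ram =
  fixes w n M :: nat
  assumes room: "8 * n + M + 40 \<le> 2 ^ w"
begin

primrec len :: "array \<Rightarrow> nat" where
  "len Flag = n" | "len Off = Suc n" | "len Nbr = M" | "len Stamp = n" | "len Queue = n"
| "len Mark = n" | "len Far = n" | "len Near = n" | "len Count = n"

primrec base :: "array \<Rightarrow> nat" where
  "base Flag = 1" | "base Off = n + 1" | "base Nbr = 2 * n + 2" | "base Stamp = 2 * n + 2 + M"
| "base Queue = 3 * n + 2 + M" | "base Mark = 4 * n + 2 + M" | "base Far = 5 * n + 2 + M"
| "base Near = 6 * n + 2 + M" | "base Count = 7 * n + 2 + M"

lemma base_bound: "i < len a \<Longrightarrow> base a + i < 2 ^ w"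
  using room by (cases a) auto

lemma base_inject:
  "i < len a \<Longrightarrow> j < len b \<Longrightarrow> base a + i = base b + j \<longleftrightarrow> a = b \<and> i = j"
  by (cases a; cases b) auto

text \<open>
  Registers below 30 hold the program variables, register 30 is used for address computations,
  and the registers above it hold the base addresses of the arrays.
\<close>

definition represents :: "state \<Rightarrow> (reg \<Rightarrow> nat) \<Rightarrow> (array \<Rightarrow> nat \<Rightarrow> nat) \<Rightarrow> bool" where
  "represents s V A \<longleftrightarrow> (\<forall>r<30. regs s r = V r) \<and> (\<forall>a. regs s (ptr a) = base a)
     \<and> (\<forall>a. \<forall>i<len a. mem s (base a + i) = A a i)"

primrec tst :: "test \<Rightarrow> (reg \<Rightarrow> nat) \<Rightarrow> bool" where
  "tst (Less i j) V \<longleftrightarrow> V i < V j"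
| "tst (Equal i j) V \<longleftrightarrow> V i = V j"

primrec tst_ok :: "test \<Rightarrow> bool" where
  "tst_ok (Less i j) \<longleftrightarrow> i < 30 \<and> j < 30"
| "tst_ok (Equal i j) \<longleftrightarrow> i < 30 \<and> j < 30"

text \<open>
  \<open>c\<close> counts time credits: \<open>P\<close> consumes at most \<open>c\<close> of them, and the postcondition \<open>Q\<close> is
  about the remaining ones.
\<close>

definition wp :: "prog \<Rightarrow> (nat \<Rightarrow> (reg \<Rightarrow> nat) \<Rightarrow> (array \<Rightarrow> nat \<Rightarrow> nat) \<Rightarrow> bool) \<Rightarrow>
    nat \<Rightarrow> (reg \<Rightarrow> nat) \<Rightarrow> (array \<Rightarrow> nat \<Rightarrow> nat) \<Rightarrow> bool" where
  "wp P Q c V A \<longleftrightarrow> (\<forall>s. represents s V A \<longrightarrow>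
     (\<exists>t s' V' A'. exec w P s t s' \<and> t \<le> c \<and> represents s' V' A' \<and> Q (c - t) V' A'))"

lemma represents_test: "represents s V A \<Longrightarrow> tst_ok b \<Longrightarrow> holds b s = tst b V"
  by (cases b) (auto simp: represents_def)

lemma represents_set_reg:
  "represents s V A \<Longrightarrow> r < 30 \<Longrightarrow> represents (set_reg r x s) (V(r := x)) A"
  using ptr_ge by (auto simp: represents_def set_reg_def dest: less_asym)

lemma represents_set_tmp:
  "represents s V A \<Longrightarrow> represents (set_reg tmp x s) V A"
  using less_imp_neq[OF ptr_ge] by (auto simp: represents_def set_reg_def)

lemma represents_reg: "represents s V A \<Longrightarrow> r < 30 \<Longrightarrow> regs s r = V r"
  by (simp add: represents_def)

lemma represents_set_mem:
  assumes "represents s V A" "i < len a"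
  shows "represents (set_mem (base a + i) x s) V (A(a := (A a)(i := x)))"
  using assms base_inject[OF assms(2)]
  by (auto simp: represents_def set_mem_def) metis+

lemma wp_conseq:
  "wp P Q' c V A \<Longrightarrow> (\<And>c V A. Q' c V A \<Longrightarrow> Q c V A) \<Longrightarrow> wp P Q c V A"
  unfolding wp_def by meson

lemma wp_Skip: "1 \<le> c \<Longrightarrow> Q (c - 1) V A \<Longrightarrow> wp Skip Q c V A"
  unfolding wp_def using exec_Skip by meson

lemma wp_basic:
  assumes "\<And>s. represents s V A \<Longrightarrow> exec w P s 1 (f s) \<and> represents (f s) V' A'"
    and "1 \<le> c" "Q (c - 1) V' A'"
  shows "wp P Q c V A"
  unfolding wp_def using assms by meson

lemma wp_Const:
  assumes "r < 30" "k < 2 ^ w" "1 \<le> c" "Q (c - 1) (V(r := k)) A"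
  shows "wp (Const r k) Q c V A"
  by (rule wp_basic[where f = "set_reg r k"])
    (use assms exec_Const[of w r k] in \<open>auto simp: represents_set_reg\<close>)

lemma wp_Move:
  assumes "r < 30" "i < 30" "1 \<le> c" "Q (c - 1) (V(r := V i)) A"
  shows "wp (Move r i) Q c V A"
proof (rule wp_basic)
  fix s assume s: "represents s V A"
  show "exec w (Move r i) s 1 (set_reg r (regs s i) s) \<and>
      represents (set_reg r (regs s i) s) (V(r := V i)) A"
    unfolding represents_reg[OF s assms(2)]
    using exec_Move[of w r i s] represents_set_reg[OF s assms(1)]
    by (simp add: represents_reg[OF s assms(2)])
qed (use assms in auto)

lemma wp_Add:
  assumes "r < 30" "i < 30" "j < 30" "V i + V j < 2 ^ w"
    "1 \<le> c" "Q (c - 1) (V(r := V i + V j)) A"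
  shows "wp (Add r i j) Q c V A"
proof (rule wp_basic)
  fix s assume s: "represents s V A"
  show "exec w (Add r i j) s 1 (set_reg r ((regs s i + regs s j) mod 2 ^ w) s) \<and>
      represents (set_reg r ((regs s i + regs s j) mod 2 ^ w) s) (V(r := V i + V j)) A"
    using exec_Add[of w r i j s] represents_set_reg[OF s assms(1)] assms(4)
    by (simp add: represents_reg[OF s assms(2)] represents_reg[OF s assms(3)])
qed (use assms in auto)

lemma wp_Seq:
  assumes "wp P (wp R Q) c V A"
  shows "wp (P ;; R) Q c V A"
  unfolding wp_def
proof (intro allI impI)
  fix s assume "represents s V A"
  with assms obtain t s1 V1 A1 where 1: "exec w P s t s1" "t \<le> c" "represents s1 V1 A1"
    "wp R Q (c - t) V1 A1" unfolding wp_def[of P] by blast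
  then obtain u s2 V2 A2 where "exec w R s1 u s2" "u \<le> c - t" "represents s2 V2 A2"
    "Q (c - t - u) V2 A2" unfolding wp_def by blast
  with 1 exec_Seq[of w P s t s1 R u s2]
  show "\<exists>t s' V' A'. exec w (P ;; R) s t s' \<and> t \<le> c \<and> represents s' V' A' \<and> Q (c - t) V' A'"
    by (intro exI[of _ "t + u"] exI[of _ s2] exI[of _ V2] exI[of _ A2]) auto
qed

lemma wp_If:
  assumes "tst_ok b" "1 \<le> c" "tst b V \<Longrightarrow> wp P Q (c - 1) V A" "\<not> tst b V \<Longrightarrow> wp R Q (c - 1) V A"
  shows "wp (IfElse b P R) Q c V A"
  unfolding wp_def
proof (intro allI impI)
  fix s assume s: "represents s V A"
  obtain t s' V' A' where "exec w (if tst b V then P else R) s t s'" "t \<le> c - 1"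
    "represents s' V' A'" "Q (c - 1 - t) V' A'"
  proof (cases "tst b V")
    case True
    with that assms(3)[OF True] s show ?thesis unfolding wp_def by auto
  next
    case False
    with that assms(4)[OF False] s show ?thesis unfolding wp_def by auto
  qed
  moreover from this have "exec w (IfElse b P R) s (Suc t) s'"
    using exec_IfElse_True exec_IfElse_False represents_test[OF s assms(1)] by (cases "tst b V") auto
  ultimately show "\<exists>t s' V' A'. exec w (IfElse b P R) s t s' \<and> t \<le> c \<and> represents s' V' A'
      \<and> Q (c - t) V' A'"
    using assms(2) by (intro exI[of _ "Suc t"] exI[of _ s'] exI[of _ V'] exI[of _ A']) auto
qed

text \<open>Every iteration consumes a credit, hence the loop terminates.\<close>

lemma wp_While:
  assumes b: "tst_ok b" and I: "I c V A"
    and step: "\<And>c V A. I c V A \<Longrightarrow> 1 \<le> c"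
      "\<And>c V A. I c V A \<Longrightarrow> tst b V \<Longrightarrow> wp P I (c - 1) V A"
      "\<And>c V A. I c V A \<Longrightarrow> \<not> tst b V \<Longrightarrow> Q (c - 1) V A"
  shows "wp (While b P) Q c V A"
proof -
  have "\<exists>t s' V' A'. exec w (While b P) s t s' \<and> t \<le> c \<and> represents s' V' A' \<and> Q (c - t) V' A'"
    if "I c V A" "represents s V A" for c s V A
    using that
  proof (induction c arbitrary: s V A rule: less_induct)
    case (less c)
    have c: "1 \<le> c" using step(1) less.prems by blast
    show ?case
    proof (cases "tst b V")
      case False
      then have "exec w (While b P) s 1 s"
        using exec_While_False represents_test[OF less.prems(2) b] by blast
      then show ?thesis using c step(3)[OF less.prems(1) False] less.prems(2) by blast
    next
      case True
      then obtain t s1 V1 A1 where 1: "exec w P s t s1" "t \<le> c - 1" "represents s1 V1 A1"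
        "I (c - 1 - t) V1 A1"
        using step(2)[OF less.prems(1)] less.prems(2) unfolding wp_def by blast
      have "c - 1 - t < c" using c by auto
      from less.IH[OF this 1(4,3)] obtain u s2 V2 A2 where 2: "exec w (While b P) s1 u s2"
        "u \<le> c - 1 - t" "represents s2 V2 A2" "Q (c - 1 - t - u) V2 A2" by blast
      have "exec w (While b P) s (Suc (t + u)) s2"
        using exec_While_True[of b s w P t s1 u s2] 1 2 True represents_test[OF less.prems(2) b] by blast
      moreover have "c - Suc (t + u) = c - 1 - t - u" by simp
      ultimately show ?thesis using 1 2 c
        by (intro exI[of _ "Suc (t + u)"] exI[of _ s2] exI[of _ V2] exI[of _ A2]) auto
    qed
  qed
  with I show ?thesis unfolding wp_def by blast
qed

lemma exec_address:
  assumes "represents s V A" "i < 30" "V i < len a"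
  shows "exec w (Add tmp (ptr a) i) s 1 (set_reg tmp (base a + V i) s)"
  using exec_Add[of w tmp "ptr a" i s] assms base_bound[OF assms(3)]
  by (simp add: represents_def)

lemma regs_set_reg: "regs (set_reg r x s) i = (if i = r then x else regs s i)"
  and mem_set_reg: "mem (set_reg r x s) = mem s"
  by (auto simp: set_reg_def)

lemma wp_Read:
  assumes "r < 30" "i < 30" "V i < len a" "2 \<le> c" "Q (c - 2) (V(r := A a (V i))) A"
  shows "wp (Read r a i) Q c V A"
  unfolding wp_def
proof (intro allI impI)
  fix s assume s: "represents s V A"
  let ?s1 = "set_reg tmp (base a + V i) s"
  have s1: "represents ?s1 V A" using s by (rule represents_set_tmp)
  have "mem s (base a + V i) = A a (V i)" using s assms(3) by (auto simp: represents_def)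
  then have "exec w (Load r tmp) ?s1 1 (set_reg r (A a (V i)) ?s1)"
    using exec_Load[of w r tmp ?s1] by (simp add: regs_set_reg mem_set_reg)
  then have "exec w (Read r a i) s (1 + 1) (set_reg r (A a (V i)) ?s1)"
    unfolding Read_def by (rule exec_Seq[OF exec_address[OF s assms(2,3)]])
  with represents_set_reg[OF s1 assms(1)] assms(4,5)
  show "\<exists>t s' V' A'. exec w (Read r a i) s t s' \<and> t \<le> c \<and> represents s' V' A' \<and> Q (c - t) V' A'"
    by (metis one_add_one)
qed

lemma wp_Write:
  assumes "r < 30" "i < 30" "V i < len a" "2 \<le> c" "Q (c - 2) V (A(a := (A a)(V i := V r)))"
  shows "wp (Write a i r) Q c V A"
  unfolding wp_def
proof (intro allI impI)
  fix s assume s: "represents s V A"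
  let ?s1 = "set_reg tmp (base a + V i) s"
  have s1: "represents ?s1 V A" using s by (rule represents_set_tmp)
  have "regs s r = V r" using s assms(1) by (auto simp: represents_def)
  then have "exec w (Store tmp r) ?s1 1 (set_mem (base a + V i) (V r) ?s1)"
    using exec_Store[of w tmp r ?s1] assms(1) by (simp add: regs_set_reg)
  then have "exec w (Write a i r) s (1 + 1) (set_mem (base a + V i) (V r) ?s1)"
    unfolding Write_def by (rule exec_Seq[OF exec_address[OF s assms(2,3)]])
  with represents_set_mem[OF s1 assms(3)] assms(4,5)
  show "\<exists>t s' V' A'. exec w (Write a i r) s t s' \<and> t \<le> c \<and> represents s' V' A' \<and> Q (c - t) V' A'"
    by (metis one_add_one)
qed

lemmas wp_rules = wp_Seq wp_Skip wp_Const wp_Move wp_Add wp_Read wp_Write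

end

section \<open>Breadth-first search and the input graph\<close>

definition nbrs :: "'a set set \<Rightarrow> 'a \<Rightarrow> 'a set" where
  "nbrs E v = {u. {v, u} \<in> E}"

text \<open>
  The queue \<open>q\<close> holds the visited vertices; the first \<open>h\<close> of them have been scanned. The first
  \<open>l\<close> entries are the vertices of distance at most \<open>d\<close> from the source \<open>b\<close>, and the vertices
  that are currently scanned have distance \<open>d\<close>.
\<close>

definition bfs_inv :: "'a set set \<Rightarrow> 'a \<Rightarrow> (nat \<Rightarrow> 'a) \<Rightarrow> nat \<Rightarrow> nat \<Rightarrow> nat \<Rightarrow> nat \<Rightarrow> bool" where
  "bfs_inv E b q h k l d \<longleftrightarrow> h \<le> l \<and> l \<le> k \<and> inj_on q {..<k}
     \<and> q ` {..<l} = {x. gdist E b x \<le> enat d}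
     \<and> q ` {..<k} = q ` {..<l} \<union> (\<Union>y\<in>q ` {..<h}. nbrs E y)
     \<and> (\<forall>i. h \<le> i \<and> i < l \<longrightarrow> gdist E b (q i) = enat d)"

lemma bfs_inv_init: "q 0 = b \<Longrightarrow> bfs_inv E b q 0 (Suc 0) (Suc 0) 0"
  unfolding bfs_inv_def
  by (auto simp: gdist_self gdist_le_0_iff[unfolded zero_enat_def] zero_enat_def lessThan_Suc)

lemma bfs_inv_next_level:
  assumes "bfs_inv E b q h k h d" "h < k"
  shows "bfs_inv E b q h k k (Suc d)"
proof -
  note inv = assms(1)[unfolded bfs_inv_def]
  have all: "q ` {..<k} = {x. gdist E b x \<le> enat (Suc d)}"
  proof -
    have "q ` {..<h} = {x. gdist E b x \<le> enat d}"
      and "q ` {..<k} = q ` {..<h} \<union> (\<Union>y\<in>q ` {..<h}. nbrs E y)"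
      using inv by blast+
    then have "q ` {..<k} = {x. gdist E b x \<le> enat d} \<union> (\<Union>y\<in>{x. gdist E b x \<le> enat d}. nbrs E y)"
      by simp
    then show ?thesis unfolding gdist_le_Suc_iff nbrs_def by auto
  qed
  have "gdist E b (q i) = enat (Suc d)" if i: "h \<le> i" "i < k" for i
  proof -
    have le: "gdist E b (q i) \<le> enat (Suc d)" using all i by auto
    have "inj_on q {..<k}" using inv by blast
    then have "q i \<notin> q ` {..<h}" using i assms(2) by (auto dest: inj_onD)
    moreover have "q ` {..<h} = {x. gdist E b x \<le> enat d}" using inv by blast
    ultimately have "\<not> gdist E b (q i) \<le> enat d" by simp
    with le show ?thesis by (cases "gdist E b (q i)") auto
  qed
  moreover have "q ` {..<k} = q ` {..<k} \<union> (\<Union>y\<in>q ` {..<h}. nbrs E y)" using inv by blast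
  moreover have "h \<le> k" "inj_on q {..<k}" using inv by blast+
  ultimately show ?thesis using all unfolding bfs_inv_def by blast
qed

lemma bfs_inv_scan:
  assumes "bfs_inv E b q h k l d" "h < l" "k \<le> k'"
    and q': "inj_on q' {..<k'}" "\<And>i. i < k \<Longrightarrow> q' i = q i"
      "q' ` {..<k'} = q ` {..<k} \<union> nbrs E (q h)"
  shows "bfs_inv E b q' (Suc h) k' l d"
proof -
  note inv = assms(1)[unfolded bfs_inv_def]
  have im: "q' ` {..<i} = q ` {..<i}" if "i \<le> k" for i
    using q'(2) that by (intro image_cong) auto
  have "q ` {..<Suc h} = insert (q h) (q ` {..<h})" by (auto simp: less_Suc_eq)
  then have "q' ` {..<Suc h} = insert (q h) (q ` {..<h})"
    using im[of "Suc h"] inv assms(2) by simp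
  moreover have "q' ` {..<l} = q ` {..<l}" using im[of l] inv by simp
  moreover have "q ` {..<k} = q ` {..<l} \<union> (\<Union>y\<in>q ` {..<h}. nbrs E y)" using inv by blast
  ultimately have "q' ` {..<k'} = q' ` {..<l} \<union> (\<Union>y\<in>q' ` {..<Suc h}. nbrs E y)"
    and "q' ` {..<l} = {x. gdist E b x \<le> enat d}"
    using q'(3) inv by (simp_all add: Un_ac)
  moreover have "\<forall>i. Suc h \<le> i \<and> i < l \<longrightarrow> gdist E b (q' i) = enat d"
    using inv q'(2) by simp
  ultimately show ?thesis using inv assms(2,3) q'(1) unfolding bfs_inv_def by simp
qed

lemma bfs_inv_done:
  assumes "bfs_inv E b q k k l d"
  shows "q ` {..<k} = {x. gdist E b x \<noteq> \<infinity>}"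
proof -
  note inv = assms(1)[unfolded bfs_inv_def]
  then have l: "l = k" by simp
  have closed: "gdist E b x \<le> enat i \<Longrightarrow> x \<in> q ` {..<k}" for x i
  proof (induction i arbitrary: x)
    case 0
    then have "gdist E b x \<le> enat d" by (rule order_trans) simp
    then show ?case using inv l by auto
  next
    case (Suc i)
    have all: "q ` {..<k} = q ` {..<k} \<union> (\<Union>y\<in>q ` {..<k}. nbrs E y)"
      using inv unfolding l by blast
    from Suc.prems consider "gdist E b x \<le> enat i" | y where "gdist E b y \<le> enat i" "{y, x} \<in> E"
      unfolding gdist_le_Suc_iff by blast
    then show ?case
    proof cases
      case 1
      then show ?thesis by (rule Suc.IH)
    next
      case (2 y)
      then have "y \<in> q ` {..<k}" "x \<in> nbrs E y" by (simp_all add: Suc.IH nbrs_def)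
      then show ?thesis by (subst all) blast
    qed
  qed
  show ?thesis
  proof (intro set_eqI iffI)
    fix x assume "x \<in> q ` {..<k}"
    then have "gdist E b x \<le> enat d" using inv l by auto
    then show "x \<in> {x. gdist E b x \<noteq> \<infinity>}" by (cases "gdist E b x") auto
  next
    fix x assume "x \<in> {x. gdist E b x \<noteq> \<infinity>}"
    then obtain i where "gdist E b x = enat i" by auto
    then show "x \<in> q ` {..<k}" using closed[of x i] by simp
  qed
qed

abbreviation (input) "rRes \<equiv> 0 :: reg"
abbreviation (input) "rInf \<equiv> 1 :: reg"
abbreviation (input) "rZero \<equiv> 2 :: reg"
abbreviation (input) "rOne \<equiv> 3 :: reg"
abbreviation (input) "rTwo \<equiv> 4 :: reg"
abbreviation (input) "rN \<equiv> 5 :: reg"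
abbreviation (input) "rV \<equiv> 6 :: reg"
abbreviation (input) "rF \<equiv> 7 :: reg"
abbreviation (input) "rJ \<equiv> 8 :: reg"
abbreviation (input) "rE \<equiv> 9 :: reg"
abbreviation (input) "rU \<equiv> 10 :: reg"
abbreviation (input) "rX \<equiv> 11 :: reg"
abbreviation (input) "rHit \<equiv> 12 :: reg"
abbreviation (input) "rCS \<equiv> 13 :: reg"
abbreviation (input) "rCT \<equiv> 14 :: reg"
abbreviation (input) "rNT \<equiv> 15 :: reg"
abbreviation (input) "rTarget \<equiv> 16 :: reg"
abbreviation (input) "rCB \<equiv> 17 :: reg"
abbreviation (input) "rBest \<equiv> 18 :: reg"
abbreviation (input) "rHead \<equiv> 19 :: reg"
abbreviation (input) "rTail \<equiv> 20 :: reg"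
abbreviation (input) "rLevel \<equiv> 21 :: reg"
abbreviation (input) "rD \<equiv> 22 :: reg"
abbreviation (input) "rId \<equiv> 23 :: reg"
abbreviation (input) "rEcc \<equiv> 24 :: reg"
abbreviation (input) "rTC \<equiv> 25 :: reg"
abbreviation (input) "rP \<equiv> 26 :: reg"
abbreviation (input) "rCentral \<equiv> 27 :: reg"
abbreviation (input) "rFar \<equiv> 28 :: reg"
abbreviation (input) "rK \<equiv> 29 :: reg"

definition for_vertices :: "prog \<Rightarrow> prog" where
  "for_vertices P = Move rV rZero ;; While (Less rV rN) (P ;; Add rV rV rOne)"

definition for_neighbors :: "reg \<Rightarrow> prog \<Rightarrow> prog" where
  "for_neighbors i P = Read rJ Off i ;; Add rX i rOne ;; Read rE Off rX ;;
     While (Less rJ rE) (Read rU Nbr rJ ;; P ;; Add rJ rJ rOne)"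

locale graph_ram = word_ram w n "length (concat adj)"
  for w n :: nat and adj :: "nat list list" +
  fixes E :: "nat set set" and S :: "nat set"
  assumes graph: "simple_graph {..<n} E"
    and S_subset: "S \<subseteq> {..<n}"
    and adj: "adjacency_lists n E adj"
begin

abbreviation "T \<equiv> {..<n} - S"

definition flag :: "nat \<Rightarrow> nat" where "flag v = (if v \<in> S then 1 else 0)"
definition off :: "nat \<Rightarrow> nat" where "off v = length (concat (take v adj))"
definition deg :: "nat \<Rightarrow> nat" where "deg v = length (adj ! v)"

definition inputs :: "(array \<Rightarrow> nat \<Rightarrow> nat) \<Rightarrow> bool" where
  "inputs A \<longleftrightarrow> A Flag = flag \<and> A Off = off \<and> A Nbr = (\<lambda>j. concat adj ! j)"

definition const_regs :: "(reg \<Rightarrow> nat) \<Rightarrow> bool" where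
  "const_regs V \<longleftrightarrow> V rZero = 0 \<and> V rOne = 1 \<and> V rTwo = 2 \<and> V rN = n"

lemma length_adj: "length adj = n"
  using adj by (simp add: adjacency_lists_def)

lemma nbrs_eq: "v < n \<Longrightarrow> nbrs E v = set (adj ! v)"
  using adj by (simp add: adjacency_lists_def nbrs_def)

lemma nbrs_less:
  assumes "u \<in> nbrs E v"
  shows "u < n"
proof -
  have "{v, u} \<subseteq> {..<n}" using graph assms unfolding simple_graph_def nbrs_def by blast
  then show ?thesis by simp
qed

lemma nbrs_sym: "u \<in> nbrs E v \<longleftrightarrow> v \<in> nbrs E u"
  by (simp add: nbrs_def insert_commute)

lemma off_0: "off 0 = 0"
  by (simp add: off_def)

lemma off_Suc: "v < n \<Longrightarrow> off (Suc v) = off v + deg v"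
  by (simp add: off_def deg_def take_Suc_conv_app_nth length_adj)

lemma off_sum: "v \<le> n \<Longrightarrow> off v = (\<Sum>u<v. deg u)"
  by (induction v) (simp_all add: off_0 off_Suc)

lemma off_n: "off n = length (concat adj)"
  by (simp add: off_def length_adj)

lemma off_le: "v \<le> n \<Longrightarrow> off v \<le> length (concat adj)"
  by (metis append_take_drop_id concat_append le_add1 length_append off_def)

lemma concat_nth:
  assumes "v < n" "i < deg v"
  shows "concat adj ! (off v + i) = adj ! v ! i"
proof -
  have "concat adj = concat (take v adj) @ adj ! v @ concat (drop (Suc v) adj)"
    using assms(1) by (metis id_take_nth_drop length_adj concat_append concat.simps(2))
  then show ?thesis using assms(2) by (simp add: off_def deg_def nth_append)
qed

lemma concat_image:
  assumes "v < n" "i \<le> deg v"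
  shows "(\<lambda>j. concat adj ! j) ` {off v..<off v + i} = set (take i (adj ! v))"
proof -
  have "(\<lambda>j. concat adj ! j) ` {off v..<off v + i} = (\<lambda>i. adj ! v ! i) ` {..<i}"
  proof (intro set_eqI iffI)
    fix x assume "x \<in> (\<lambda>j. concat adj ! j) ` {off v..<off v + i}"
    then obtain j where j: "off v \<le> j" "j < off v + i" "x = concat adj ! j" by auto
    then have "x = adj ! v ! (j - off v)"
      using concat_nth[of v "j - off v"] assms by simp
    with j show "x \<in> (\<lambda>i. adj ! v ! i) ` {..<i}" by force
  next
    fix x assume "x \<in> (\<lambda>i. adj ! v ! i) ` {..<i}"
    then obtain k where k: "k < i" "x = adj ! v ! k" by auto
    then have "x = concat adj ! (off v + k)" using concat_nth[of v k] assms by simp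
    with k show "x \<in> (\<lambda>j. concat adj ! j) ` {off v..<off v + i}" by force
  qed
  also have "\<dots> = set (take i (adj ! v))"
    using assms nth_image[of i "adj ! v"] by (simp add: deg_def atLeast0LessThan)
  finally show ?thesis .
qed

lemma concat_image_nbrs:
  "v < n \<Longrightarrow> (\<lambda>j. concat adj ! j) ` {off v..<off v + deg v} = nbrs E v"
  using concat_image[of v "deg v"] by (simp add: nbrs_eq deg_def)

lemma wp_for_vertices:
  assumes "const_regs V" "I 0 (V(rV := 0)) A"
    and c: "2 + (\<Sum>v<n. cost v + 2) \<le> c"
    and step: "\<And>v c V A. v < n \<Longrightarrow> V rV = v \<Longrightarrow> I v V A \<Longrightarrow> cost v \<le> c \<Longrightarrow>
      wp P (\<lambda>c' V' A'. c \<le> c' + cost v \<and> V' rV = v \<and> I (Suc v) V' A') c V A"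
    and I_rV: "\<And>v V A y. I v V A \<Longrightarrow> I v (V(rV := y)) A"
    and I_const_regs: "\<And>v V A. I v V A \<Longrightarrow> const_regs V"
    and post: "\<And>c' V A. I n V A \<Longrightarrow> c \<le> c' + (2 + (\<Sum>v<n. cost v + 2)) \<Longrightarrow> Q c' V A"
  shows "wp (for_vertices P) Q c V A"
proof -
  let ?cost = "\<lambda>v. \<Sum>u<v. cost u + 2"
  let ?J = "\<lambda>c' V A. V rV \<le> n \<and> I (V rV) V A \<and> c - 1 \<le> c' + ?cost (V rV)"
  have mono: "?cost v \<le> ?cost n" if "v \<le> n" for v
    using that by (intro sum_mono2) auto
  have "wp (While (Less rV rN) (P ;; Add rV rV rOne)) Q (c - 1) (V(rV := 0)) A"
  proof (rule wp_While[where I = ?J])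
    fix c' V A assume J: "?J c' V A"
    with mono[of "V rV"] c show "1 \<le> c'" by linarith
    from J I_const_regs have V: "V rOne = 1" "V rN = n" "V rZero = 0" by (auto simp: const_regs_def)
    {
      assume "tst (Less rV rN) V"
      then have v: "V rV < n" by (simp add: V)
      have "c - 1 \<le> c' + ?cost (V rV)" using J by blast
      moreover have "?cost (V rV) + (cost (V rV) + 2) \<le> ?cost n" using mono[of "Suc (V rV)"] v by simp
      ultimately have c': "cost (V rV) + 3 \<le> c'" using c by linarith
      have "wp P (\<lambda>c'' V' A'. c' - 1 \<le> c'' + cost (V rV) \<and> V' rV = V rV \<and> I (Suc (V rV)) V' A') (c' - 1) V A"
        using v J c' by (intro step) auto
      then have "wp P (wp (Add rV rV rOne) ?J) (c' - 1) V A"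
      proof (rule wp_conseq)
        fix c'' V' A'
        assume *: "c' - 1 \<le> c'' + cost (V rV) \<and> V' rV = V rV \<and> I (Suc (V rV)) V' A'"
        then have "const_regs V'" using I_const_regs by blast
        with * c' v room J I_rV show "wp (Add rV rV rOne) ?J c'' V' A'"
          by (intro wp_Add) (auto simp: const_regs_def)
      qed
      then show "wp (P ;; Add rV rV rOne) ?J (c' - 1) V A" by (rule wp_Seq)
    }
    {
      assume "\<not> tst (Less rV rN) V"
      with J have "V rV = n" by (simp add: V)
      with J c show "Q (c' - 1) V A" by (intro post) auto
    }
  qed (use assms in auto)
  with c assms(1) show ?thesis
    unfolding for_vertices_def by (intro wp_Seq wp_Move) (auto simp: const_regs_def)
qed

lemma wp_for_neighbors:
  assumes i: "i < 30" "i \<notin> {rJ, rX, rE}" "V i < n"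
    and I0: "I {} V A"
    and c: "6 + (k + 4) * deg (V i) \<le> c"
    and step: "\<And>X u c V' A. u \<in> nbrs E (V i) \<Longrightarrow> I X V' A \<Longrightarrow> V' rU = u \<Longrightarrow> k \<le> c \<Longrightarrow>
      wp P (\<lambda>c' V'' A'. c \<le> c' + k \<and> V'' rJ = V' rJ \<and> V'' rE = V' rE \<and> I (insert u X) V'' A') c V' A"
    and I_upd: "\<And>X V A r y. r \<in> {rJ, rE, rU, rX} \<Longrightarrow> I X V A \<Longrightarrow> I X (V(r := y)) A"
    and I_inputs: "\<And>X V A. I X V A \<Longrightarrow> const_regs V \<and> inputs A"
    and post: "\<And>c' V' A. I (nbrs E (V i)) V' A \<Longrightarrow> c \<le> c' + (6 + (k + 4) * deg (V i)) \<Longrightarrow> Q c' V' A"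
  shows "wp (for_neighbors i P) Q c V A"
proof -
  let ?v = "V i"
  let ?V = "V(rJ := off ?v, rX := Suc ?v, rE := off (Suc ?v))"
  let ?N = "\<lambda>j. (\<lambda>j. concat adj ! j) ` {off ?v..<j}"
  let ?J = "\<lambda>c' V A. off ?v \<le> V rJ \<and> V rJ \<le> off ?v + deg ?v \<and> V rE = off ?v + deg ?v \<and> I (?N (V rJ)) V A
    \<and> c - 5 \<le> c' + (k + 4) * (V rJ - off ?v)"
  note end_le = off_le[of "Suc ?v"] off_Suc[OF i(3)]
  have V: "V rOne = 1" "A Off = off" using I_inputs[OF I0] by (auto simp: const_regs_def inputs_def)
  have "wp (While (Less rJ rE) (Read rU Nbr rJ ;; P ;; Add rJ rJ rOne)) Q (c - 5) ?V A"
  proof (rule wp_While[where I = ?J])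
    show "?J (c - 5) ?V A"
      using I0 off_Suc[OF i(3)] by (simp add: I_upd)
  next
    fix c' V' A assume J: "?J c' V' A"
    then have "(k + 4) * (V' rJ - off ?v) \<le> (k + 4) * deg ?v" by (intro mult_le_mono) auto
    with J c show "1 \<le> c'" by linarith
    from J I_inputs have V': "V' rOne = 1" "A Nbr = (\<lambda>j. concat adj ! j)"
      by (auto simp: const_regs_def inputs_def)
    {
      assume "tst (Less rJ rE) V'"
      with J have j: "V' rJ < off ?v + deg ?v" by simp
      let ?u = "concat adj ! (V' rJ)"
      have "(k + 4) * Suc (V' rJ - off ?v) \<le> (k + 4) * deg ?v"
        using j J by (intro mult_le_mono) auto
      then have "(k + 4) + (k + 4) * (V' rJ - off ?v) \<le> (k + 4) * deg ?v" by simp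
      moreover have "c - 5 \<le> c' + (k + 4) * (V' rJ - off ?v)" using J by blast
      ultimately have c': "k + 4 + 1 \<le> c'" using c by linarith
      have u: "?u \<in> nbrs E ?v"
        using J j concat_image_nbrs[OF i(3)] by force
      have ins: "?N (Suc (V' rJ)) = insert ?u (?N (V' rJ))"
        using J by (simp add: atLeastLessThanSuc)
      have jlen: "V' rJ < len Nbr" using j end_le i(3) by simp
      have "wp P (\<lambda>c'' V'' A'. c' - 3 \<le> c'' + k \<and> V'' rJ = (V'(rU := ?u)) rJ \<and> V'' rE = (V'(rU := ?u)) rE
          \<and> I (insert ?u (?N (V' rJ))) V'' A') (c' - 3) (V'(rU := ?u)) A"
        using J c' by (intro step u I_upd) auto
      then have "wp P (wp (Add rJ rJ rOne) ?J) (c' - 3) (V'(rU := ?u)) A"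
      proof (rule wp_conseq)
        fix c'' V'' A'
        assume *: "c' - 3 \<le> c'' + k \<and> V'' rJ = (V'(rU := ?u)) rJ \<and> V'' rE = (V'(rU := ?u)) rE
          \<and> I (insert ?u (?N (V' rJ))) V'' A'"
        then have "V'' rOne = 1" using I_inputs by (auto simp: const_regs_def)
        moreover have "(k + 4) * (Suc (V' rJ) - off ?v) = (k + 4) * (V' rJ - off ?v) + (k + 4)"
          using J by (simp add: Suc_diff_le)
        moreover have "V' rJ + 1 < 2 ^ w" using jlen room by simp
        ultimately show "wp (Add rJ rJ rOne) ?J c'' V'' A'"
          using * J j c' ins by (intro wp_Add) (auto simp: I_upd)
      qed
      then show "wp (Read rU Nbr rJ ;; P ;; Add rJ rJ rOne) ?J (c' - 1) V' A"
        using c' jlen by (intro wp_Seq wp_Read) (auto simp: V' numeral_3_eq_3 numeral_2_eq_2)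
    }
    {
      assume "\<not> tst (Less rJ rE) V'"
      with J have "V' rJ = off ?v + deg ?v" by simp
      with J c concat_image_nbrs[OF i(3)] show "Q (c' - 1) V' A" by (intro post) auto
    }
  qed simp
  with c i V room show ?thesis
    unfolding for_neighbors_def
    by (intro wp_Seq wp_Read wp_Add) (auto simp: numeral_eq_Suc)
qed

end

section \<open>Marking the boundary\<close>

definition mark_neighbor :: prog where
  "mark_neighbor = Read rX Flag rU ;; IfElse (Equal rX rF) Skip (Move rHit rK)"

definition mark_vertex :: prog where
  "mark_vertex = Read rF Flag rV ;; Move rHit rZero ;; Add rK rF rOne ;;
     for_neighbors rV mark_neighbor ;; Write Mark rV rHit ;; Write Near rV rN ;;
     IfElse (Equal rHit rTwo) (Add rCS rCS rOne)
       (IfElse (Equal rHit rOne) (Add rCT rCT rOne) Skip) ;;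
     IfElse (Equal rF rZero) (Add rNT rNT rOne) Skip"

definition choose_boundary :: prog where
  "choose_boundary = Move rBest rN ;; IfElse (Less rCT rCS)
     (Move rTarget rOne ;; Move rCB rCT) (Move rTarget rTwo ;; Move rCB rCS)"

definition visit :: prog where
  "visit = Read rX Far rP ;; IfElse (Less rX rD) (Write Far rP rD) Skip ;;
     Read rX Near rP ;; IfElse (Less rD rX) (Write Near rP rD) Skip ;;
     Read rX Count rP ;; Add rX rX rOne ;; Write Count rP rX ;;
     Read rX Flag rP ;; IfElse (Equal rX rZero) (Add rTC rTC rOne ;; Move rEcc rD) Skip"

definition enqueue_neighbor :: prog where
  "enqueue_neighbor = Read rX Stamp rU ;; IfElse (Equal rX rId) Skip
     (Write Stamp rU rId ;; Write Queue rTail rU ;; Add rTail rTail rOne)"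

lemma card_Int_lessThan_Suc:
  "card (X \<inter> {..<Suc v}) = card (X \<inter> {..<v}) + (if v \<in> X then 1 else 0)"
  by (simp add: lessThan_Suc Int_insert_right)

context graph_ram
begin

abbreviation "S' \<equiv> with_neighbor_in E S T"
abbreviation "T' \<equiv> with_neighbor_in E T S"

definition mark :: "nat \<Rightarrow> nat" where
  "mark v = (if v \<in> S' then 2 else if v \<in> T' then 1 else 0)"

lemma flag_less: "flag v < 2"
  by (simp add: flag_def)

lemma mark_eq:
  assumes "v < n"
  shows "mark v = (if \<exists>u\<in>nbrs E v. flag u \<noteq> flag v then Suc (flag v) else 0)"
  using assms nbrs_less[of _ v] S_subset
  by (auto simp: mark_def flag_def with_neighbor_in_def nbrs_def)

lemma wp_mark_neighbors:
  assumes V: "const_regs V" "inputs A" "V rV < n" "V rF = flag (V rV)" "V rK = Suc (flag (V rV))"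
      "V rHit = 0"
    and c: "6 + 8 * deg (V rV) \<le> c"
    and post: "\<And>c' V'. \<forall>r. r \<notin> {rJ, rE, rU, rX, rHit} \<longrightarrow> V' r = V r \<Longrightarrow>
      V' rHit = mark (V rV) \<Longrightarrow> c \<le> c' + (6 + 8 * deg (V rV)) \<Longrightarrow> Q c' V' A"
  shows "wp (for_neighbors rV mark_neighbor) Q c V A"
proof -
  let ?v = "V rV"
  define hit where "hit X = (if \<exists>u\<in>X. flag u \<noteq> flag ?v then Suc (flag ?v) else 0)" for X
  have hit: "hit {} = 0" "hit (nbrs E ?v) = mark ?v"
    "hit (insert u X) = (if flag u = flag ?v then hit X else Suc (flag ?v))" for u X
    using V(3) by (auto simp: hit_def mark_eq)
  let ?I = "\<lambda>X V' A'. A' = A \<and> (\<forall>r. r \<notin> {rJ, rE, rU, rX, rHit} \<longrightarrow> V' r = V r)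
    \<and> V' rHit = hit X"
  show ?thesis
  proof (rule wp_for_neighbors[where I = ?I and k = 4])
    fix X u and c :: nat and V' A'
    assume *: "u \<in> nbrs E ?v" "?I X V' A'" "V' rU = u" "4 \<le> c"
    then have "u < n" "A' Flag = flag" using nbrs_less V(2) by (auto simp: inputs_def)
    with * V show "wp mark_neighbor (\<lambda>c' V'' A'. c \<le> c' + 4 \<and> V'' rJ = V' rJ \<and> V'' rE = V' rE
        \<and> ?I (insert u X) V'' A') c V' A'"
      unfolding mark_neighbor_def by (intro wp_rules wp_If) (simp_all add: hit)
  next
    fix c' V' A'
    assume "?I (nbrs E ?v) V' A'" "c \<le> c' + (6 + (4 + 4) * deg ?v)"
    then show "Q c' V' A'" using post[of V' c'] by (simp add: hit)
  qed (use V c in \<open>auto simp: const_regs_def hit\<close>)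
qed

definition marked :: "nat \<Rightarrow> (reg \<Rightarrow> nat) \<Rightarrow> (array \<Rightarrow> nat \<Rightarrow> nat) \<Rightarrow> bool" where
  "marked v V A \<longleftrightarrow> const_regs V \<and> inputs A \<and> V rInf = 0
     \<and> V rCS = card (S' \<inter> {..<v}) \<and> V rCT = card (T' \<inter> {..<v}) \<and> V rNT = card (T \<inter> {..<v})
     \<and> (\<forall>u<v. A Mark u = mark u \<and> A Near u = n)
     \<and> (\<forall>u<n. A Stamp u = 0 \<and> A Far u = 0 \<and> A Count u = 0)"

lemma wp_mark_vertex:
  assumes v: "v < n" "V rV = v" and I: "marked v V A" and c: "30 + 8 * deg v \<le> c"
  shows "wp mark_vertex (\<lambda>c' V' A'. c \<le> c' + (30 + 8 * deg v) \<and> V' rV = v \<and> marked (Suc v) V' A') c V A"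
proof -
  have le: "card (X \<inter> {..<v}) < n" for X
    using card_mono[of "{..<v}" "X \<inter> {..<v}"] v by simp
  have m: "mark v = 2 \<longleftrightarrow> v \<in> S'" "mark v = Suc 0 \<longleftrightarrow> v \<in> T'" "flag v = 0 \<longleftrightarrow> v \<in> T"
    and disj: "v \<in> S' \<Longrightarrow> v \<notin> T'" "v \<in> S' \<Longrightarrow> v \<in> S"
    using v by (auto simp: mark_def flag_def with_neighbor_in_def)
  show ?thesis
    using v I c room le[of S'] le[of T'] le[of T] flag_less[of v] m(2) disj
    unfolding mark_vertex_def marked_def const_regs_def inputs_def
    by (intro wp_rules wp_If wp_mark_neighbors)
      (auto simp: const_regs_def inputs_def card_Int_lessThan_Suc m less_Suc_eq)
qed

definition front :: "(nat \<Rightarrow> nat) \<Rightarrow> nat \<Rightarrow> nat set" where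
  "front q k = q ` {..<k}"

definition visited :: "nat \<Rightarrow> (nat \<Rightarrow> nat) \<Rightarrow> nat set" where
  "visited s g = {u. u < n \<and> g u = s}"

lemma front_upd: "front (q(k := u)) (Suc k) = insert u (front q k)"
  unfolding front_def lessThan_Suc by auto

lemma visited_upd: "u < n \<Longrightarrow> visited s (g(u := s)) = insert u (visited s g)"
  unfolding visited_def by auto

lemma tail_less:
  assumes "inj_on q {..<k}" "front q k = visited s g" "u < n" "g u \<noteq> s"
  shows "k < n"
proof -
  have "visited s g \<subset> {..<n}" using assms by (auto simp: visited_def)
  then have "card (visited s g) < card {..<n}" by (intro psubset_card_mono) auto
  moreover have "card (front q k) = k" using assms(1) by (simp add: card_image front_def)
  ultimately show ?thesis using assms(2) by simp
qed

lemma inj_on_upd: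
  assumes "inj_on q {..<k}" "u \<notin> front q k"
  shows "inj_on (q(k := u)) {..<Suc k}"
  unfolding lessThan_Suc
proof (rule inj_onI)
  fix x y assume "x \<in> insert k {..<k}" "y \<in> insert k {..<k}" "(q(k := u)) x = (q(k := u)) y"
  with assms show "x = y" by (auto simp: front_def split: if_splits dest: inj_onD)
qed

lemma wp_enqueue_neighbors:
  assumes V: "const_regs V" "inputs A" "V rP < n"
    and inj: "inj_on (A Queue) {..<V rTail}"
    and vis: "front (A Queue) (V rTail) = visited (V rId) (A Stamp)"
    and c: "6 + 12 * deg (V rP) \<le> c"
    and post: "\<And>c' V' A'. \<forall>r. r \<notin> {rJ, rE, rU, rX, rTail} \<longrightarrow> V' r = V r \<Longrightarrow>
      \<forall>a. a \<notin> {Stamp, Queue} \<longrightarrow> A' a = A a \<Longrightarrow>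
      V rTail \<le> V' rTail \<Longrightarrow> inj_on (A' Queue) {..<V' rTail} \<Longrightarrow>
      front (A' Queue) (V' rTail) = visited (V rId) (A' Stamp) \<Longrightarrow>
      visited (V rId) (A' Stamp) = front (A Queue) (V rTail) \<union> nbrs E (V rP) \<Longrightarrow>
      \<forall>i<V rTail. A' Queue i = A Queue i \<Longrightarrow>
      \<forall>u<n. A' Stamp u = V rId \<or> A' Stamp u = A Stamp u \<Longrightarrow>
      c \<le> c' + (6 + 12 * deg (V rP)) \<Longrightarrow> Q c' V' A'"
  shows "wp (for_neighbors rP enqueue_neighbor) Q c V A"
proof -
  let ?p = "V rP"
  let ?I = "\<lambda>X V' A'. (\<forall>r. r \<notin> {rJ, rE, rU, rX, rTail} \<longrightarrow> V' r = V r)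
    \<and> (\<forall>a. a \<notin> {Stamp, Queue} \<longrightarrow> A' a = A a)
    \<and> V rTail \<le> V' rTail \<and> inj_on (A' Queue) {..<V' rTail}
    \<and> front (A' Queue) (V' rTail) = visited (V rId) (A' Stamp)
    \<and> visited (V rId) (A' Stamp) = front (A Queue) (V rTail) \<union> X
    \<and> (\<forall>i<V rTail. A' Queue i = A Queue i)
    \<and> (\<forall>u<n. A' Stamp u = V rId \<or> A' Stamp u = A Stamp u)"
  show ?thesis
  proof (rule wp_for_neighbors[where I = ?I and k = 8])
    fix X u and c :: nat and V' A'
    assume u: "u \<in> nbrs E ?p" and I: "?I X V' A'" and V': "V' rU = u" and c: "8 \<le> c"
    have u_n: "u < n" using nbrs_less u by blast
    have reg: "V' rId = V rId" "V' rOne = 1" using I V(1) by (simp_all add: const_regs_def)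
    have I_front: "front (A' Queue) (V' rTail) = visited (V rId) (A' Stamp)"
      "visited (V rId) (A' Stamp) = front (A Queue) (V rTail) \<union> X"
      and I_inj: "inj_on (A' Queue) {..<V' rTail}" using I by blast+
    show "wp enqueue_neighbor (\<lambda>c' V'' A'. c \<le> c' + 8 \<and> V'' rJ = V' rJ \<and> V'' rE = V' rE
        \<and> ?I (insert u X) V'' A') c V' A'"
    proof (cases "A' Stamp u = V rId")
      case True
      then have "u \<in> visited (V rId) (A' Stamp)" using u_n by (simp add: visited_def)
      then have "visited (V rId) (A' Stamp) = front (A Queue) (V rTail) \<union> insert u X"
        using I_front by blast
      then have I': "?I (insert u X) V' A'" using I by blast
      then have "?I (insert u X) (V'(rX := A' Stamp u)) A'" by simp
      then show ?thesis
        using True V' c u_n reg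
        unfolding enqueue_neighbor_def by (intro wp_rules wp_If) simp_all
    next
      case False
      let ?k = "V' rTail"
      let ?A = "A'(Stamp := (A' Stamp)(u := V rId), Queue := (A' Queue)(?k := u))"
      have k: "?k < n" using tail_less I_inj I_front(1) u_n False by blast
      have "u \<notin> front (A' Queue) ?k" unfolding I_front(1) using False by (simp add: visited_def)
      then have inj: "inj_on (?A Queue) {..<Suc ?k}" using inj_on_upd[OF I_inj] by simp
      have front: "front (?A Queue) (Suc ?k) = visited (V rId) (?A Stamp)"
        "visited (V rId) (?A Stamp) = front (A Queue) (V rTail) \<union> insert u X"
        using I_front visited_upd[OF u_n] by (simp_all add: front_upd)
      have "?I (insert u X) (V'(rX := A' Stamp u, rTail := Suc ?k)) ?A"
        using inj front I by simp
      then show ?thesis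
        using False V' c u_n k room reg
        unfolding enqueue_neighbor_def by (intro wp_rules wp_If) (simp_all del: fun_upd_apply add: fun_upd_same fun_upd_other)
    qed
  next
    fix c' V' A'
    assume I: "?I (nbrs E ?p) V' A'" and "c \<le> c' + (6 + (8 + 4) * deg ?p)"
    then show "Q c' V' A'" by (intro post) simp_all
  next
    show "?I {} V A" using inj vis by simp
  next
    fix X V' A' and r :: reg and y assume "r \<in> {rJ, rE, rU, rX}" "?I X V' A'"
    then show "?I X (V'(r := y)) A'" by (elim insertE emptyE) simp_all
  next
    fix X V' A' assume "?I X V' A'"
    with V show "const_regs V' \<and> inputs A'" by (simp add: const_regs_def inputs_def)
  qed (use V c in auto)
qed

lemma wp_visit:
  assumes V: "const_regs V" "inputs A" "V rP < n" and c: "20 \<le> c"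
    and small: "A Count (V rP) < n" "V rTC < n"
    and post: "\<And>c' V'. \<forall>r. r \<notin> {rX, rTC, rEcc} \<longrightarrow> V' r = V r \<Longrightarrow>
      V' rTC = (if V rP \<in> S then V rTC else Suc (V rTC)) \<Longrightarrow>
      V' rEcc = (if V rP \<in> S then V rEcc else V rD) \<Longrightarrow> c \<le> c' + 20 \<Longrightarrow>
      Q c' V' (A(Far := (A Far)(V rP := max (A Far (V rP)) (V rD)),
        Near := (A Near)(V rP := min (A Near (V rP)) (V rD)),
        Count := (A Count)(V rP := Suc (A Count (V rP)))))"
  shows "wp visit Q c V A"
proof -
  have A: "A Flag (V rP) = flag (V rP)" and V1: "V rOne = 1" "V rZero = 0"
    using V by (auto simp: inputs_def const_regs_def)
  have post': "Q c' V' A'"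
    if "\<forall>r. r \<notin> {rX, rTC, rEcc} \<longrightarrow> V' r = V r"
      "V' rTC = (if V rP \<in> S then V rTC else Suc (V rTC))"
      "V' rEcc = (if V rP \<in> S then V rEcc else V rD)" "c \<le> c' + 20"
      "A' = A(Far := (A Far)(V rP := max (A Far (V rP)) (V rD)),
        Near := (A Near)(V rP := min (A Near (V rP)) (V rD)),
        Count := (A Count)(V rP := Suc (A Count (V rP))))" for c' V' A'
    using post that by blast
  show ?thesis
    unfolding visit_def
    using V(3) c small room
    by (intro wp_rules wp_If) (auto simp: A V1 flag_def max_def min_def fun_eq_iff
      split: if_splits intro!: post')
qed

end

section \<open>The search from a boundary vertex\<close>

definition bfs_step :: prog where
  "bfs_step = IfElse (Equal rHead rLevel) (Add rD rD rOne ;; Move rLevel rTail) Skip ;;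
     Read rP Queue rHead ;; Add rHead rHead rOne ;; visit ;; for_neighbors rP enqueue_neighbor"

definition bfs :: prog where
  "bfs = Add rId rV rOne ;; Write Stamp rV rId ;; Write Queue rZero rV ;;
     Move rHead rZero ;; Move rTail rOne ;; Move rLevel rOne ;;
     Move rD rZero ;; Move rEcc rZero ;; Move rTC rZero ;;
     While (Less rHead rTail) bfs_step ;;
     IfElse (Equal rTC rNT) (IfElse (Less rEcc rBest) (Move rBest rEcc) Skip) Skip"

abbreviation (input) bfs_regs :: "reg set" where
  "bfs_regs \<equiv> {rJ, rE, rU, rX, rHead, rTail, rLevel, rD, rEcc, rTC, rP}"

context graph_ram
begin

lemma front_Suc: "front q (Suc k) = insert (q k) (front q k)"
  unfolding front_def lessThan_Suc by auto

definition dst :: "nat \<Rightarrow> nat \<Rightarrow> nat" where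
  "dst b u = the_enat (gdist E b u)"

definition collected :: "nat \<Rightarrow> nat set \<Rightarrow> (array \<Rightarrow> nat \<Rightarrow> nat) \<Rightarrow> (array \<Rightarrow> nat \<Rightarrow> nat) \<Rightarrow> bool" where
  "collected b P A0 A \<longleftrightarrow> (\<forall>u<n.
     A Far u = (if u \<in> P then max (A0 Far u) (dst b u) else A0 Far u)
     \<and> A Near u = (if u \<in> P then min (A0 Near u) (dst b u) else A0 Near u)
     \<and> A Count u = (if u \<in> P then Suc (A0 Count u) else A0 Count u))"

definition bfs_state :: "nat \<Rightarrow> (array \<Rightarrow> nat \<Rightarrow> nat) \<Rightarrow> (reg \<Rightarrow> nat) \<Rightarrow> (array \<Rightarrow> nat \<Rightarrow> nat) \<Rightarrow> bool" where
  "bfs_state b A0 V A \<longleftrightarrow> const_regs V \<and> inputs A \<and> V rId = Suc b \<and> A Mark = A0 Mark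
     \<and> (\<forall>u<n. A Stamp u = Suc b \<or> A Stamp u = A0 Stamp u)
     \<and> bfs_inv E b (A Queue) (V rHead) (V rTail) (V rLevel) (V rD)
     \<and> front (A Queue) (V rTail) = visited (Suc b) (A Stamp)
     \<and> (\<forall>y\<in>visited (Suc b) (A Stamp). nbrs E y \<noteq> {})
     \<and> V rD < n
     \<and> collected b (front (A Queue) (V rHead)) A0 A
     \<and> V rTC = card (front (A Queue) (V rHead) \<inter> T)
     \<and> enat (V rEcc) = (SUP t\<in>front (A Queue) (V rHead) \<inter> T. gdist E b t)"

lemma bfs_state_facts:
  assumes "bfs_state b A0 V A"
  shows "inj_on (A Queue) {..<V rTail}" "V rHead \<le> V rLevel" "V rLevel \<le> V rTail"
    "\<And>i. i < V rTail \<Longrightarrow> A Queue i < n" "V rTail \<le> n"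
proof -
  have inv: "bfs_inv E b (A Queue) (V rHead) (V rTail) (V rLevel) (V rD)"
    and fr: "front (A Queue) (V rTail) = visited (Suc b) (A Stamp)"
    using assms unfolding bfs_state_def by blast+
  show inj: "inj_on (A Queue) {..<V rTail}" and "V rHead \<le> V rLevel" "V rLevel \<le> V rTail"
    using inv unfolding bfs_inv_def by blast+
  have sub: "front (A Queue) (V rTail) \<subseteq> {..<n}" unfolding fr visited_def by blast
  then show "\<And>i. i < V rTail \<Longrightarrow> A Queue i < n" unfolding front_def by blast
  have "card (A Queue ` {..<V rTail}) \<le> card {..<n}"
    using sub unfolding front_def by (intro card_mono) auto
  with inj show "V rTail \<le> n" by (simp add: card_image)
qed

lemma bfs_state_level:
  assumes st: "bfs_state b A0 V A" and b: "b < n" and lt: "V rHead < V rTail"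
    and eq: "V rHead = V rLevel"
  shows "bfs_state b A0 (V(rD := Suc (V rD), rLevel := V rTail)) A" (is "bfs_state b A0 ?V A")
    and "Suc (V rD) < n"
proof -
  have inv: "bfs_inv E b (A Queue) (V rHead) (V rTail) (V rHead) (V rD)"
    using st unfolding bfs_state_def eq by blast
  have inv': "bfs_inv E b (A Queue) (V rHead) (V rTail) (V rTail) (Suc (V rD))"
    by (rule bfs_inv_next_level[OF inv lt])
  then have "gdist E b (A Queue (V rHead)) = enat (Suc (V rD))"
    using lt unfolding bfs_inv_def by blast
  then show d: "Suc (V rD) < n"
    using gdist_less_card[OF graph, of b "A Queue (V rHead)"] b by simp
  show "bfs_state b A0 ?V A"
    using st inv' d unfolding bfs_state_def const_regs_def by simp
qed

lemma wp_bfs_step: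
  assumes b: "b < n" and st: "bfs_state b A0 V A" and lt: "V rHead < V rTail"
    and count: "\<And>u. u < n \<Longrightarrow> A0 Count u < n"
    and c: "40 + 12 * deg (A Queue (V rHead)) \<le> c"
    and post: "\<And>c' V' A'. bfs_state b A0 V' A' \<Longrightarrow> \<forall>r. r \<notin> bfs_regs \<longrightarrow> V' r = V r \<Longrightarrow>
      V' rHead = Suc (V rHead) \<Longrightarrow> \<forall>i<V rTail. A' Queue i = A Queue i \<Longrightarrow>
      c \<le> c' + (40 + 12 * deg (A Queue (V rHead))) \<Longrightarrow> Q c' V' A'"
  shows "wp bfs_step Q c V A"
proof -
  let ?h = "V rHead"
  define p where "p = A Queue ?h"
  define V1 where "V1 = (if ?h = V rLevel then V(rD := Suc (V rD), rLevel := V rTail) else V)"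
  have st1: "bfs_state b A0 V1 A"
    using bfs_state_level(1)[OF st b lt] st by (simp add: V1_def)
  have V1: "V1 rHead = ?h" "V1 rTail = V rTail" "?h < V1 rLevel"
    "\<And>r. r \<notin> {rD, rLevel} \<Longrightarrow> V1 r = V r"
    using bfs_state_facts(2)[OF st] lt by (auto simp: V1_def)
  have st1_facts: "const_regs V1" "inputs A" "V1 rId = Suc b" "A Mark = A0 Mark"
    "\<forall>u<n. A Stamp u = Suc b \<or> A Stamp u = A0 Stamp u"
    "bfs_inv E b (A Queue) ?h (V rTail) (V1 rLevel) (V1 rD)"
    "front (A Queue) (V rTail) = visited (Suc b) (A Stamp)"
    "\<forall>y\<in>visited (Suc b) (A Stamp). nbrs E y \<noteq> {}"
    "V1 rD < n" "collected b (front (A Queue) ?h) A0 A"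
    "V1 rTC = card (front (A Queue) ?h \<inter> T)"
    "enat (V1 rEcc) = (SUP t\<in>front (A Queue) ?h \<inter> T. gdist E b t)"
    using st1 unfolding bfs_state_def V1(1,2) by blast+
  have inj: "inj_on (A Queue) {..<V rTail}"
    and range: "\<And>i. i < V rTail \<Longrightarrow> A Queue i < n" and "V rTail \<le> n"
    using bfs_state_facts(1,4,5)[OF st] by blast+
  with lt have h: "?h < n" and p: "p < n" by (auto simp: p_def)
  have dp: "gdist E b p = enat (V1 rD)"
    using st1_facts(6) V1(3) unfolding bfs_inv_def p_def by blast
  have near: "gdist E b t \<le> enat (V1 rD)" if "t \<in> front (A Queue) ?h" for t
  proof -
    have "t \<in> A Queue ` {..<V1 rLevel}" using that V1(3) unfolding front_def by auto
    moreover have "A Queue ` {..<V1 rLevel} = {x. gdist E b x \<le> enat (V1 rD)}"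
      using st1_facts(6) unfolding bfs_inv_def by blast
    ultimately show ?thesis by simp
  qed
  have fresh: "p \<notin> front (A Queue) ?h"
    using inj lt by (auto simp: front_def p_def dest: inj_onD)
  have "front (A Queue) ?h \<inter> T \<subseteq> {..<n} - {p}" using fresh by blast
  then have "front (A Queue) ?h \<inter> T \<subset> {..<n}" using p by blast
  then have "card (front (A Queue) ?h \<inter> T) < card {..<n}" by (intro psubset_card_mono) auto
  then have tc: "V1 rTC < n" using st1_facts(11) by simp
  have cnt: "A Count p < n"
    using st1_facts(10) fresh p count by (simp add: collected_def)
  define A3 where "A3 = A(Far := (A Far)(p := max (A Far p) (V1 rD)),
        Near := (A Near)(p := min (A Near p) (V1 rD)),
        Count := (A Count)(p := Suc (A Count p)))"
  have scan: "wp (for_neighbors rP enqueue_neighbor) Q c3 V3 A3"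
    if V3: "\<forall>r. r \<notin> {rX, rTC, rEcc, rP, rHead} \<longrightarrow> V3 r = V1 r" "V3 rP = p" "V3 rHead = Suc ?h"
      "V3 rTC = (if p \<in> S then V1 rTC else Suc (V1 rTC))"
      "V3 rEcc = (if p \<in> S then V1 rEcc else V1 rD)" and c3: "c \<le> c3 + 30" for c3 V3
  proof (rule wp_enqueue_neighbors)
    fix c' V' A'
    assume V': "\<forall>r. r \<notin> {rJ, rE, rU, rX, rTail} \<longrightarrow> V' r = V3 r"
      and A': "\<forall>a. a \<notin> {Stamp, Queue} \<longrightarrow> A' a = A3 a"
      and tl: "V3 rTail \<le> V' rTail" and inj': "inj_on (A' Queue) {..<V' rTail}"
      and fr: "front (A' Queue) (V' rTail) = visited (V3 rId) (A' Stamp)"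
      and vis: "visited (V3 rId) (A' Stamp) = front (A3 Queue) (V3 rTail) \<union> nbrs E (V3 rP)"
      and q: "\<forall>i<V3 rTail. A' Queue i = A3 Queue i"
      and stamp: "\<forall>u<n. A' Stamp u = V3 rId \<or> A' Stamp u = A3 Stamp u"
      and c': "c3 \<le> c' + (6 + 12 * deg (V3 rP))"
    have A3: "A3 Queue = A Queue" "A3 Stamp = A Stamp" by (simp_all add: A3_def)
    have V3': "V3 rTail = V rTail" "V3 rId = Suc b" using V3(1) V1(2) st1_facts(3) by simp_all
    have q': "\<And>i. i < V rTail \<Longrightarrow> A' Queue i = A Queue i" using q by (simp add: A3 V3')
    note fr = fr[unfolded V3'] and vis = vis[unfolded V3' A3 V3(2)]
    have P: "front (A' Queue) (Suc ?h) = insert p (front (A Queue) ?h)"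
      unfolding front_Suc using q' lt by (auto simp: front_def p_def)
    have inv: "bfs_inv E b (A' Queue) (Suc ?h) (V' rTail) (V1 rLevel) (V1 rD)"
    proof (rule bfs_inv_scan[OF st1_facts(6) V1(3) _ inj' q'])
      show "V rTail \<le> V' rTail" using tl V3' by simp
      show "A' Queue ` {..<V' rTail} = A Queue ` {..<V rTail} \<union> nbrs E (A Queue ?h)"
        using fr vis unfolding front_def p_def by simp
    qed
    have regs: "V' rHead = Suc ?h" "V' rLevel = V1 rLevel" "V' rD = V1 rD" "V' rId = Suc b"
      "V' rTC = V3 rTC" "V' rEcc = V3 rEcc"
      using V' V3 V3' by simp_all
    have nbr: "\<forall>y\<in>visited (Suc b) (A' Stamp). nbrs E y \<noteq> {}"
      using st1_facts(7,8) nbrs_sym unfolding vis by blast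
    have coll: "collected b (insert p (front (A Queue) ?h)) A0 A'"
      using st1_facts(10) fresh A' dp by (simp add: collected_def A3_def dst_def)
    have fin: "finite (front (A Queue) ?h \<inter> T)" by (simp add: front_def)
    have tc': "V3 rTC = card (insert p (front (A Queue) ?h) \<inter> T)"
      using V3(4) st1_facts(11) fresh p fin by (simp add: Int_insert_left)
    have "(SUP t\<in>front (A Queue) ?h \<inter> T. gdist E b t) \<le> enat (V1 rD)"
      using near by (intro SUP_least) auto
    then have ecc': "enat (V3 rEcc) = (SUP t\<in>insert p (front (A Queue) ?h) \<inter> T. gdist E b t)"
      using V3(5) st1_facts(12) p dp by (simp add: Int_insert_left sup_absorb1)
    have "bfs_state b A0 V' A'"
      unfolding bfs_state_def regs P
    proof (intro conjI)
      show "const_regs V'" using st1_facts(1) V3(1) V' by (simp add: const_regs_def)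
      show "inputs A'" using st1_facts(2) A' by (simp add: inputs_def A3_def)
      show "A' Mark = A0 Mark" using st1_facts(4) A' by (simp add: A3_def)
      show "\<forall>u<n. A' Stamp u = Suc b \<or> A' Stamp u = A0 Stamp u"
        using stamp st1_facts(5) unfolding V3' A3 by metis
    qed (use inv fr nbr st1_facts(9) coll tc' ecc' in simp_all)
    then show "Q c' V' A'"
      using V' V3 V1 q' c' c3 by (intro post) (auto simp: p_def)
  qed (use V3 V1 st1_facts inj p c c3 in \<open>simp_all add: A3_def const_regs_def inputs_def p_def\<close>)
  have vis: "wp visit (wp (for_neighbors rP enqueue_neighbor) Q) c2 (V1(rP := p, rHead := Suc ?h)) A"
    if c2: "c \<le> c2 + 6" for c2
  proof (rule wp_visit)
    let ?V2 = "V1(rP := p, rHead := Suc ?h)"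
    fix c' V'
    assume "\<forall>r. r \<notin> {rX, rTC, rEcc} \<longrightarrow> V' r = ?V2 r"
      "V' rTC = (if ?V2 rP \<in> S then ?V2 rTC else Suc (?V2 rTC))"
      "V' rEcc = (if ?V2 rP \<in> S then ?V2 rEcc else ?V2 rD)" "c2 \<le> c' + 20"
    with c2 have "wp (for_neighbors rP enqueue_neighbor) Q c' V' A3"
      by (intro scan) simp_all
    then show "wp (for_neighbors rP enqueue_neighbor) Q c' V' (A(Far := (A Far)(?V2 rP := max (A Far (?V2 rP)) (?V2 rD)),
        Near := (A Near)(?V2 rP := min (A Near (?V2 rP)) (?V2 rD)),
        Count := (A Count)(?V2 rP := Suc (A Count (?V2 rP)))))"
      by (simp add: A3_def)
  qed (use st1_facts(1,2) p c c2 tc cnt in \<open>simp_all add: const_regs_def\<close>)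
  have rest: "wp (Read rP Queue rHead)
      (wp (Add rHead rHead rOne ;; visit ;; for_neighbors rP enqueue_neighbor) Q) c1 V1 A" if c1: "c \<le> c1 + 3" for c1
    using vis V1(1) h c c1 room st1_facts(1)
    by (intro wp_rules) (simp_all add: const_regs_def p_def)
  have one: "V rOne = 1" using st by (simp add: bfs_state_def const_regs_def)
  show ?thesis
  proof (cases "?h = V rLevel")
    case True
    with bfs_state_level(2)[OF st b lt] rest c room one show ?thesis
      unfolding bfs_step_def by (intro wp_Seq wp_If wp_Add wp_Move) (simp_all add: V1_def)
  next
    case False
    with rest c show ?thesis
      unfolding bfs_step_def by (intro wp_Seq wp_If wp_Skip) (simp_all add: V1_def)
  qed
qed

end

definition process_vertex :: prog where
  "process_vertex = Read rX Mark rV ;; IfElse (Equal rX rTarget) bfs Skip"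

context graph_ram
begin

lemma bfs_state_init:
  assumes V: "const_regs V" "inputs A" "V rV = b" "b < n" "nbrs E b \<noteq> {}"
    and stamp: "\<forall>u<n. A Stamp u \<le> b"
  shows "bfs_state b A
    (V(rId := Suc b, rHead := 0, rTail := 1, rLevel := 1, rD := 0, rEcc := 0, rTC := 0))
    (A(Stamp := (A Stamp)(b := Suc b), Queue := (A Queue)(0 := b)))"
proof -
  have "visited (Suc b) (A Stamp) = {}" using stamp by (fastforce simp: visited_def)
  then have vis: "visited (Suc b) ((A Stamp)(b := Suc b)) = {b}"
    using V(4) by (simp add: visited_upd)
  have fr: "front q 0 = {}" "front ((A Queue)(0 := b)) (Suc 0) = {b}" for q
    by (auto simp: front_def)
  have "bfs_inv E b ((A Queue)(0 := b)) 0 (Suc 0) (Suc 0) 0" by (rule bfs_inv_init) simp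
  with vis fr V show ?thesis
    by (simp add: bfs_state_def const_regs_def inputs_def collected_def flip: zero_enat_def bot_enat_def)
qed

lemma bfs_state_done:
  assumes st: "bfs_state b A0 V A" and eq: "\<not> V rHead < V rTail"
  shows "collected b {u. gdist E b u \<noteq> \<infinity>} A0 A"
    and "V rTC = card T \<Longrightarrow> enat (V rEcc) = ecc_ST E T b"
    and "V rTC \<noteq> card T \<Longrightarrow> ecc_ST E T b = \<infinity>"
proof -
  have tl: "V rTail = V rHead" using bfs_state_facts(2,3)[OF st] eq by linarith
  have inv: "bfs_inv E b (A Queue) (V rHead) (V rHead) (V rLevel) (V rD)"
    and coll: "collected b (front (A Queue) (V rHead)) A0 A"
    and tc: "V rTC = card (front (A Queue) (V rHead) \<inter> T)"
    and ecc: "enat (V rEcc) = (SUP t\<in>front (A Queue) (V rHead) \<inter> T. gdist E b t)"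
    using st unfolding bfs_state_def tl by blast+
  have fr: "front (A Queue) (V rHead) = {u. gdist E b u \<noteq> \<infinity>}"
    using bfs_inv_done[OF inv] unfolding front_def .
  show "collected b {u. gdist E b u \<noteq> \<infinity>} A0 A" using coll unfolding fr .
  show "enat (V rEcc) = ecc_ST E T b" if "V rTC = card T"
  proof -
    have "front (A Queue) (V rHead) \<inter> T = T"
      by (rule card_subset_eq) (use tc that in auto)
    with ecc show ?thesis by (simp add: ecc_ST_def)
  qed
  show "ecc_ST E T b = \<infinity>" if "V rTC \<noteq> card T"
  proof -
    have "front (A Queue) (V rHead) \<inter> T \<noteq> T" using tc that by metis
    then obtain t where "t \<in> T" "gdist E b t = \<infinity>" unfolding fr by blast
    then have "\<infinity> \<le> ecc_ST E T b" unfolding ecc_ST_def by (metis SUP_upper)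
    then show ?thesis by simp
  qed
qed

lemma wp_bfs:
  assumes V: "const_regs V" "inputs A" "V rV = b" "b < n" "nbrs E b \<noteq> {}" "V rNT = card T"
    and stamp: "\<forall>u<n. A Stamp u \<le> b"
    and count: "\<And>u. u < n \<Longrightarrow> A Count u < n"
    and c: "30 + 60 * length (concat adj) \<le> c"
    and post: "\<And>c' V' A'. \<forall>r. r \<notin> bfs_regs \<union> {rId, rBest} \<longrightarrow> V' r = V r \<Longrightarrow> inputs A' \<Longrightarrow>
      A' Mark = A Mark \<Longrightarrow> \<forall>u<n. A' Stamp u \<le> Suc b \<Longrightarrow>
      collected b {u. gdist E b u \<noteq> \<infinity>} A A' \<Longrightarrow>
      enat (V' rBest) = min (enat (V rBest)) (ecc_ST E T b) \<Longrightarrow>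
      c \<le> c' + (30 + 60 * length (concat adj)) \<Longrightarrow> Q c' V' A'"
  shows "wp bfs Q c V A"
proof -
  let ?M = "length (concat adj)"
  let ?V0 = "V(rId := Suc b, rHead := 0, rTail := 1, rLevel := 1, rD := 0, rEcc := 0, rTC := 0)"
  let ?A0 = "A(Stamp := (A Stamp)(b := Suc b), Queue := (A Queue)(0 := b))"
  let ?R = "IfElse (Equal rTC rNT) (IfElse (Less rEcc rBest) (Move rBest rEcc) Skip) Skip"
  let ?work = "\<lambda>V A. \<Sum>y\<in>front (A Queue) (V rHead). deg y"
  let ?J = "\<lambda>c' V' A'. bfs_state b A V' A' \<and> (\<forall>r. r \<notin> bfs_regs \<longrightarrow> V' r = ?V0 r)
    \<and> c \<le> c' + 11 + 60 * ?work V' A'"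
  have work: "?work V' A' \<le> ?M" if "bfs_state b A V' A'" for V' A'
  proof -
    have "front (A' Queue) (V' rHead) \<subseteq> {..<n}"
      using bfs_state_facts(2,3,4)[OF that] by (auto simp: front_def)
    then have "?work V' A' \<le> (\<Sum>y<n. deg y)" by (intro sum_mono2) auto
    then show ?thesis using off_sum[of n] off_n by simp
  qed
  have "wp (While (Less rHead rTail) bfs_step) (wp ?R Q) c1 ?V0 ?A0" if c1: "c \<le> c1 + 11" for c1
  proof (rule wp_While[where I = ?J])
    show "?J c1 ?V0 ?A0"
      using c1 bfs_state_init[OF V(1-5) stamp] by simp
  next
    fix c' V' A' assume J: "?J c' V' A'"
    then have st: "bfs_state b A V' A'" and cr: "c \<le> c' + 11 + 60 * ?work V' A'"
      and frame: "\<forall>r. r \<notin> bfs_regs \<longrightarrow> V' r = ?V0 r" by blast+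
    have c'_ge: "19 \<le> c'" using work[OF st] cr c by linarith
    then show "1 \<le> c'" by simp
    {
      assume "tst (Less rHead rTail) V'"
      then have lt: "V' rHead < V' rTail" by simp
      let ?p = "A' Queue (V' rHead)"
      note facts = bfs_state_facts[OF st]
      have p: "?p < n" using facts(4) lt by blast
      have fresh: "?p \<notin> front (A' Queue) (V' rHead)"
        using facts(1) lt by (auto simp: front_def dest: inj_onD)
      have "?p \<in> front (A' Queue) (V' rTail)" using lt by (auto simp: front_def)
      then have "nbrs E ?p \<noteq> {}" using st unfolding bfs_state_def by blast
      then have deg: "1 \<le> deg ?p" using nbrs_eq[OF p] by (simp add: deg_def Suc_le_eq)
      have sum: "(\<Sum>y\<in>front (A' Queue) (Suc (V' rHead)). deg y) = ?work V' A' + deg ?p"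
        using fresh unfolding front_Suc by (simp add: front_def)
      have "front (A' Queue) (Suc (V' rHead)) \<subseteq> {..<n}"
        using facts(4) lt by (auto simp: front_def)
      then have "(\<Sum>y\<in>front (A' Queue) (Suc (V' rHead)). deg y) \<le> (\<Sum>y<n. deg y)"
        by (intro sum_mono2) auto
      then have "?work V' A' + deg ?p \<le> ?M" using off_sum[of n] off_n sum by simp
      then have c_p: "60 * deg ?p \<le> c'" using cr c by linarith
      show "wp bfs_step ?J (c' - 1) V' A'"
      proof (rule wp_bfs_step[OF V(4) st lt count])
        show "40 + 12 * deg ?p \<le> c' - 1" using c_p deg by linarith
      next
        fix c'' V'' A''
        assume new: "bfs_state b A V'' A''" "\<forall>r. r \<notin> bfs_regs \<longrightarrow> V'' r = V' r"
          "V'' rHead = Suc (V' rHead)" "\<forall>i<V' rTail. A'' Queue i = A' Queue i"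
          "c' - 1 \<le> c'' + (40 + 12 * deg ?p)"
        have "front (A'' Queue) (V'' rHead) = front (A' Queue) (Suc (V' rHead))"
          using new(3,4) lt unfolding front_def by (intro image_cong) auto
        then have "c \<le> c'' + 11 + 60 * ?work V'' A''" using sum new(5) cr deg by simp
        with new(1,2) frame show "?J c'' V'' A''" by simp
      qed
    }
    {
      assume "\<not> tst (Less rHead rTail) V'"
      then have "\<not> V' rHead < V' rTail" by simp
      note fin = bfs_state_done[OF st this]
      have nt: "V' rNT = card T" and best: "V' rBest = V rBest" using frame V(6) by simp_all
      have st': "inputs A'" "A' Mark = A Mark" "\<forall>u<n. A' Stamp u = Suc b \<or> A' Stamp u = A Stamp u"
        using st unfolding bfs_state_def by blast+
      have stamp': "\<forall>u<n. A' Stamp u \<le> Suc b" using st'(3) stamp by (metis le_SucI order_refl)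
      have post': "Q c'' (V'(rBest := y)) A'"
        if "enat y = min (enat (V rBest)) (ecc_ST E T b)" "c' \<le> c'' + 4" for c'' y
        using that frame cr c work[OF st] st'(1,2) stamp' fin(1) by (intro post) simp_all
      have keep: "Q c'' V' A'"
        if "enat (V rBest) = min (enat (V rBest)) (ecc_ST E T b)" "c' \<le> c'' + 4" for c''
        using post'[of "V rBest" c''] that fun_upd_idem[of "V'" rBest, OF best] by simp
      show "wp ?R Q (c' - 1) V' A'"
      proof (cases "V' rTC = card T")
        case True
        from fin(2)[OF True, symmetric] True nt best c'_ge show ?thesis
          by (intro wp_If wp_Move wp_Skip) (auto intro!: post' keep simp: min_def)
      next
        case False
        from fin(3)[OF False] False nt c'_ge show ?thesis
          by (intro wp_If wp_Move wp_Skip) (auto intro!: keep)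
      qed
    }
  qed simp
  then show ?thesis
    using V c room unfolding bfs_def const_regs_def
    by (intro wp_rules) simp_all
qed

end

section \<open>Combining the searches\<close>

definition combine_vertex :: prog where
  "combine_vertex = Read rF Flag rV ;; IfElse (Equal rF rOne)
     (Read rX Count rV ;; IfElse (Equal rX rCB)
       (Read rX Far rV ;; IfElse (Less rX rCentral) (Move rCentral rX) Skip) Skip)
     (Read rX Near rV ;; IfElse (Less rFar rX) (Move rFar rX) Skip)"

definition finish :: prog where
  "finish = Add rX rN rN ;; Move rRes rX ;;
     IfElse (Less rBest rN) (Add rRes rBest rOne) Skip ;;
     IfElse (Less rCentral rN) (IfElse (Less rFar rN)
       (Add rF rCentral rFar ;; IfElse (Less rF rRes) (Move rRes rF) Skip) Skip) Skip ;;
     IfElse (Equal rRes rX) (Const rInf 1) Skip"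

definition main :: prog where
  "main = for_vertices mark_vertex ;; choose_boundary ;; for_vertices process_vertex ;; Move rCentral rN ;; Move rFar rZero ;;
     for_vertices combine_vertex ;; finish"

context graph_ram
begin

abbreviation "B \<equiv> boundary E S T"

lemma boundary_cases: "B = S' \<or> B = T'"
  by (simp add: boundary_def Let_def)

lemma boundary_less: "b \<in> B \<Longrightarrow> b < n"
  using boundary_cases S_subset by (auto simp: with_neighbor_in_def)

lemma boundary_nbrs: "b \<in> B \<Longrightarrow> nbrs E b \<noteq> {}"
  using boundary_cases by (auto simp: with_neighbor_in_def nbrs_def)

lemma finite_boundary: "finite B"
  using boundary_less by (meson finite_nat_set_iff_bounded)

text \<open>In \<open>Near\<close> and \<open>best\<close> the number \<open>n\<close> stands for \<open>\<infinity>\<close>, as finite distances are below \<open>n\<close>.\<close>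

definition summary :: "nat set \<Rightarrow> nat \<Rightarrow> (array \<Rightarrow> nat \<Rightarrow> nat) \<Rightarrow> bool" where
  "summary X best A \<longleftrightarrow> enat best = min (enat n) (INF b\<in>X. ecc_ST E T b) \<and> (\<forall>u<n.
     A Count u = card {b \<in> X. gdist E b u \<noteq> \<infinity>}
     \<and> enat (A Far u) = (SUP b\<in>{b \<in> X. gdist E b u \<noteq> \<infinity>}. gdist E b u)
     \<and> enat (A Near u) = min (enat n) (INF b\<in>X. gdist E b u))"

lemma summary_insert:
  assumes s: "summary X best A" and c: "collected b {u. gdist E b u \<noteq> \<infinity>} A A'"
    and best: "enat best' = min (enat best) (ecc_ST E T b)"
    and X: "finite X" "b \<notin> X"
  shows "summary (insert b X) best' A'"
  unfolding summary_def
proof (intro conjI allI impI)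
  show "enat best' = min (enat n) (INF b\<in>insert b X. ecc_ST E T b)"
    using s best by (simp add: summary_def inf_min min.assoc min.commute min.left_commute)
next
  fix u assume u: "u < n"
  let ?X = "{b \<in> X. gdist E b u \<noteq> \<infinity>}"
  let ?Y = "{x \<in> insert b X. gdist E x u \<noteq> \<infinity>}"
  have old: "A Count u = card ?X" "enat (A Far u) = (SUP b\<in>?X. gdist E b u)"
    "enat (A Near u) = min (enat n) (INF b\<in>X. gdist E b u)"
    using s u by (auto simp: summary_def)
  have new: "A' Far u = (if gdist E b u \<noteq> \<infinity> then max (A Far u) (dst b u) else A Far u)"
    "A' Near u = (if gdist E b u \<noteq> \<infinity> then min (A Near u) (dst b u) else A Near u)"
    "A' Count u = (if gdist E b u \<noteq> \<infinity> then Suc (A Count u) else A Count u)"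
    using c u by (auto simp: collected_def)
  have Y: "?Y = (if gdist E b u = \<infinity> then ?X else insert b ?X)" by auto
  show "A' Count u = card ?Y"
    using X old(1) new(3) unfolding Y by simp
  show "enat (A' Far u) = (SUP b\<in>?Y. gdist E b u)"
  proof (cases "gdist E b u")
    case (enat k)
    then have "enat (A' Far u) = max (enat (A Far u)) (gdist E b u)"
      using new(1) by (simp add: dst_def max_def)
    then show ?thesis using enat old(2) unfolding Y by (simp add: sup_max max.commute)
  next
    case infinity
    then show ?thesis using new(1) old(2) unfolding Y by simp
  qed
  show "enat (A' Near u) = min (enat n) (INF b\<in>insert b X. gdist E b u)"
  proof (cases "gdist E b u")
    case (enat k)
    then have "enat (A' Near u) = min (enat (A Near u)) (gdist E b u)"
      using new(2) by (simp add: dst_def min_def)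
    then show ?thesis using old(3) by (simp add: inf_min min.assoc min.commute min.left_commute)
  next
    case infinity
    then show ?thesis using new(2) old(3) by (simp add: inf_min)
  qed
qed

definition swept :: "nat \<Rightarrow> (reg \<Rightarrow> nat) \<Rightarrow> (array \<Rightarrow> nat \<Rightarrow> nat) \<Rightarrow> bool" where
  "swept v V A \<longleftrightarrow> const_regs V \<and> inputs A \<and> V rInf = 0 \<and> V rNT = card T \<and> V rCB = card B
     \<and> (\<forall>u<n. A Mark u = V rTarget \<longleftrightarrow> u \<in> B) \<and> (\<forall>u<n. A Stamp u \<le> v)
     \<and> summary (B \<inter> {..<v}) (V rBest) A"

definition sweep_cost :: "nat \<Rightarrow> nat" where
  "sweep_cost v = (if v \<in> B then 40 + 60 * length (concat adj) else 4)"

lemma wp_process_vertex: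
  assumes v: "v < n" "V rV = v" and I: "swept v V A" and c: "sweep_cost v \<le> c"
  shows "wp process_vertex (\<lambda>c' V' A'. c \<le> c' + sweep_cost v \<and> V' rV = v \<and> swept (Suc v) V' A') c V A"
    (is "wp _ ?Q _ _ _")
proof -
  have I': "const_regs V" "inputs A" "V rInf = 0" "V rNT = card T" "V rCB = card B"
    "\<forall>u<n. A Mark u = V rTarget \<longleftrightarrow> u \<in> B" "\<forall>u<n. A Stamp u \<le> v"
    "summary (B \<inter> {..<v}) (V rBest) A"
    using I unfolding swept_def by blast+
  show ?thesis
  proof (cases "v \<in> B")
    case False
    then have "B \<inter> {..<Suc v} = B \<inter> {..<v}" by (auto simp: less_Suc_eq)
    with I' have "swept (Suc v) (V(rX := A Mark v)) A"
      unfolding swept_def const_regs_def by (simp add: le_SucI)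
    moreover have "A Mark v \<noteq> V rTarget" using False I'(6) v by blast
    ultimately show ?thesis
      using v c False unfolding process_vertex_def
      by (intro wp_rules wp_If) (simp_all add: sweep_cost_def)
  next
    case True
    then have X: "B \<inter> {..<Suc v} = insert v (B \<inter> {..<v})" by (auto simp: less_Suc_eq)
    have count: "A Count u < n" if "u < n" for u
    proof -
      have "A Count u = card {b \<in> B \<inter> {..<v}. gdist E b u \<noteq> \<infinity>}"
        using I'(8) that by (simp add: summary_def)
      also have "\<dots> \<le> card {..<v}" by (intro card_mono) auto
      finally show ?thesis using v by simp
    qed
    have "wp bfs ?Q c1 (V(rX := A Mark v)) A" if c1: "c \<le> c1 + 3" for c1
    proof (rule wp_bfs[where b = v])
      fix c' V' A'
      assume *: "\<forall>r. r \<notin> bfs_regs \<union> {rId, rBest} \<longrightarrow> V' r = (V(rX := A Mark v)) r" "inputs A'"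
        "A' Mark = A Mark" "\<forall>u<n. A' Stamp u \<le> Suc v"
        "collected v {u. gdist E v u \<noteq> \<infinity>} A A'"
        "enat (V' rBest) = min (enat ((V(rX := A Mark v)) rBest)) (ecc_ST E T v)"
        "c1 \<le> c' + (30 + 60 * length (concat adj))"
      have "summary (B \<inter> {..<Suc v}) (V' rBest) A'"
        unfolding X using * by (intro summary_insert[OF I'(8)]) auto
      then show "?Q c' V' A'"
        using * I' v c1 True unfolding swept_def const_regs_def by (simp add: sweep_cost_def)
    qed (use I' v c c1 True count boundary_nbrs in \<open>simp_all add: const_regs_def sweep_cost_def\<close>)
    moreover have "A Mark v = V rTarget" using True I'(6) v by blast
    ultimately show ?thesis
      using v c True unfolding process_vertex_def
      by (intro wp_Seq wp_Read wp_If) (simp_all add: sweep_cost_def)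
  qed
qed

definition combined :: "nat \<Rightarrow> (reg \<Rightarrow> nat) \<Rightarrow> (array \<Rightarrow> nat \<Rightarrow> nat) \<Rightarrow> bool" where
  "combined v V A \<longleftrightarrow> const_regs V \<and> inputs A \<and> V rInf = 0 \<and> V rCB = card B
     \<and> summary B (V rBest) A
     \<and> enat (V rCentral) = min (enat n) (INF u\<in>S \<inter> {..<v}. SUP b\<in>B. gdist E b u)
     \<and> enat (V rFar) = min (enat n) (SUP u\<in>T \<inter> {..<v}. INF b\<in>B. gdist E b u)"

lemma summary_eccentricity:
  assumes "summary B best A" "u < n"
  shows "(SUP b\<in>B. gdist E b u) = (if A Count u = card B then enat (A Far u) else \<infinity>)"
proof (cases "\<exists>b\<in>B. gdist E b u = \<infinity>")
  case True
  then obtain b where b: "b \<in> B" "gdist E b u = \<infinity>" by blast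
  then have "{b \<in> B. gdist E b u \<noteq> \<infinity>} \<subset> B" by blast
  then have "A Count u < card B"
    using assms psubset_card_mono[OF finite_boundary] by (simp add: summary_def)
  moreover have "\<infinity> \<le> (SUP b\<in>B. gdist E b u)" using SUP_upper[OF b(1), of "\<lambda>b. gdist E b u"] b(2) by simp
  ultimately show ?thesis by simp
next
  case False
  then have "{b \<in> B. gdist E b u \<noteq> \<infinity>} = B" by auto
  with assms show ?thesis by (simp add: summary_def)
qed

lemma wp_combine_vertex:
  assumes v: "v < n" "V rV = v" and I: "combined v V A" and c: "10 \<le> c"
  shows "wp combine_vertex (\<lambda>c' V' A'. c \<le> c' + 10 \<and> V' rV = v \<and> combined (Suc v) V' A') c V A"
    (is "wp _ ?Q _ _ _")
proof -
  have I': "const_regs V" "inputs A" "V rInf = 0" "V rCB = card B" "summary B (V rBest) A"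
    "enat (V rCentral) = min (enat n) (INF u\<in>S \<inter> {..<v}. SUP b\<in>B. gdist E b u)"
    "enat (V rFar) = min (enat n) (SUP u\<in>T \<inter> {..<v}. INF b\<in>B. gdist E b u)"
    using I unfolding combined_def by blast+
  have A: "A Flag v = flag v" and V: "V rOne = 1" using I' by (auto simp: inputs_def const_regs_def)
  have frame: "combined (Suc v) V' A"
    if "\<forall>r. r \<notin> {rF, rX, rCentral, rFar} \<longrightarrow> V' r = V r"
      "enat (V' rCentral) = min (enat n) (INF u\<in>S \<inter> {..<Suc v}. SUP b\<in>B. gdist E b u)"
      "enat (V' rFar) = min (enat n) (SUP u\<in>T \<inter> {..<Suc v}. INF b\<in>B. gdist E b u)" for V'
    using that I' unfolding combined_def const_regs_def by simp
  show ?thesis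
  proof (cases "v \<in> S")
    case True
    then have "S \<inter> {..<Suc v} = insert v (S \<inter> {..<v})" "T \<inter> {..<Suc v} = T \<inter> {..<v}"
      by (auto simp: less_Suc_eq)
    with I'(6,7) have eqs:
      "min (enat n) (INF u\<in>S \<inter> {..<Suc v}. SUP b\<in>B. gdist E b u)
        = min (enat (V rCentral)) (if A Count v = card B then enat (A Far v) else \<infinity>)"
      "min (enat n) (SUP u\<in>T \<inter> {..<Suc v}. INF b\<in>B. gdist E b u) = enat (V rFar)"
      using summary_eccentricity[OF I'(5) v(1)]
      by (simp_all add: inf_min min.assoc min.commute min.left_commute)
    show ?thesis
      using v(1) c True unfolding combine_vertex_def
      by (intro wp_rules wp_If) (auto simp: A V v(2) I'(4) flag_def min_def intro!: frame[unfolded eqs])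
  next
    case False
    then have "S \<inter> {..<Suc v} = S \<inter> {..<v}" "T \<inter> {..<Suc v} = insert v (T \<inter> {..<v})"
      using v by (auto simp: less_Suc_eq)
    moreover have near: "enat (A Near v) = min (enat n) (INF b\<in>B. gdist E b v)"
      using I'(5) v by (simp add: summary_def)
    ultimately have eqs:
      "min (enat n) (INF u\<in>S \<inter> {..<Suc v}. SUP b\<in>B. gdist E b u) = enat (V rCentral)"
      "min (enat n) (SUP u\<in>T \<inter> {..<Suc v}. INF b\<in>B. gdist E b u)
        = max (enat (V rFar)) (enat (A Near v))"
      using I'(6,7) by (simp_all add: sup_max min_max_distrib2 max.commute)
    show ?thesis
      using v(1) c False unfolding combine_vertex_def
      by (intro wp_rules wp_If) (auto simp: A V v(2) I'(4) flag_def max_def intro!: frame[unfolded eqs] split: if_splits)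
  qed
qed

lemma min_sentinel:
  assumes "enat x = min (enat n) e" "e \<noteq> \<infinity> \<Longrightarrow> e < enat n"
  shows "e = (if x < n then enat x else \<infinity>)"
  using assms by (cases e) (auto simp: min_def split: if_splits)

lemma min_sentinel_le: "enat x = min (enat n) e \<Longrightarrow> x \<le> n"
  by (cases e) (auto simp: min_def split: if_splits)

lemma SUP_less_sentinel:
  assumes "\<And>x. x \<in> X \<Longrightarrow> f x \<noteq> \<infinity> \<Longrightarrow> f x < enat n" "(SUP x\<in>X. f x) \<noteq> \<infinity>" "0 < n"
  shows "(SUP x\<in>X. f x) < enat n"
proof -
  have "f x \<le> enat (n - 1)" if "x \<in> X" for x
  proof -
    have "f x \<le> (SUP x\<in>X. f x)" using that by (rule SUP_upper)
    have "f x \<noteq> \<infinity>"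
    proof
      assume "f x = \<infinity>"
      with \<open>f x \<le> _\<close> assms(2) show False by simp
    qed
    then show ?thesis using assms(1)[OF that] by (cases "f x") auto
  qed
  then have "(SUP x\<in>X. f x) \<le> enat (n - 1)" by (rule SUP_least)
  also have "\<dots> < enat n" using assms(3) by simp
  finally show ?thesis .
qed

lemma INF_less_sentinel:
  assumes "\<And>x. x \<in> X \<Longrightarrow> f x \<noteq> \<infinity> \<Longrightarrow> f x < enat n" "(INF x\<in>X. f x) \<noteq> \<infinity>"
  shows "(INF x\<in>X. f x) < enat n"
proof (cases "X = {}")
  case True
  with assms(2) show ?thesis by (simp add: top_enat_def)
next
  case False
  then obtain x where "x \<in> X" "(INF x\<in>X. f x) = f x" using enat_INF_attained[of X f] by blast
  with assms show ?thesis by simp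
qed

lemma gdist_sentinel: "b \<in> B \<Longrightarrow> gdist E b u \<noteq> \<infinity> \<Longrightarrow> gdist E b u < enat n"
  using gdist_less_card[OF graph, of b u] boundary_less by simp

lemma estimate_registers:
  assumes "combined n V A"
  shows "estimate E S T B = min ((if V rBest < n then enat (V rBest) else \<infinity>) + 1)
    ((if V rCentral < n then enat (V rCentral) else \<infinity>) + (if V rFar < n then enat (V rFar) else \<infinity>))"
proof (cases "n = 0")
  case True
  have "S = {}" "B = {}" using True S_subset boundary_less by auto
  with True show ?thesis by (simp add: estimate_def top_enat_def)
next
  case False
  have int: "S \<inter> {..<n} = S" "T \<inter> {..<n} = T" using S_subset by auto
  have best: "enat (V rBest) = min (enat n) (INF b\<in>B. ecc_ST E T b)"
    and central: "enat (V rCentral) = min (enat n) (INF u\<in>S. SUP b\<in>B. gdist E b u)"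
    and far: "enat (V rFar) = min (enat n) (SUP u\<in>T. INF b\<in>B. gdist E b u)"
    using assms unfolding combined_def summary_def int by blast+
  have "(INF b\<in>B. ecc_ST E T b) = (if V rBest < n then enat (V rBest) else \<infinity>)"
    using False unfolding ecc_ST_def
    by (intro min_sentinel[OF best[unfolded ecc_ST_def]] INF_less_sentinel SUP_less_sentinel gdist_sentinel) auto
  moreover have "(INF u\<in>S. SUP b\<in>B. gdist E b u) = (if V rCentral < n then enat (V rCentral) else \<infinity>)"
    using False
    by (intro min_sentinel[OF central] INF_less_sentinel SUP_less_sentinel gdist_sentinel) auto
  moreover have "(SUP u\<in>T. INF b\<in>B. gdist E b u) = (if V rFar < n then enat (V rFar) else \<infinity>)"
    using False
    by (intro min_sentinel[OF far] INF_less_sentinel SUP_less_sentinel gdist_sentinel) auto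
  ultimately show ?thesis unfolding estimate_def by simp
qed

lemma wp_finish:
  assumes I: "combined n V A" and c: "20 \<le> c"
    and post: "\<And>c' V'. (if V' rInf = 0 then enat (V' rRes) else \<infinity>) = estimate E S T B \<Longrightarrow> Q c' V' A"
  shows "wp finish Q c V A"
proof -
  have V: "V rN = n" "V rOne = 1" "V rInf = 0" using I by (auto simp: combined_def const_regs_def)
  have le: "V rBest \<le> n" "V rCentral \<le> n" "V rFar \<le> n"
    using I unfolding combined_def summary_def by (blast intro: min_sentinel_le)+
  define e where "e = estimate E S T B"
  have e: "e = min ((if V rBest < n then enat (V rBest) else \<infinity>) + 1)
    ((if V rCentral < n then enat (V rCentral) else \<infinity>) + (if V rFar < n then enat (V rFar) else \<infinity>))"
    unfolding e_def by (rule estimate_registers[OF I])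
  show ?thesis
    unfolding finish_def
    using V le c room
    by (intro wp_rules wp_If)
      (simp_all, (rule post[folded e_def], simp add: e one_enat_def min_def)+)
qed

end

section \<open>Initialization and running time\<close>

definition setup_regs :: prog where
  "setup_regs = Const rOne 1 ;; Const rTwo 2 ;; Load rN rZero ;;
     Const (ptr Flag) 1 ;; Add (ptr Off) rN rOne ;; Add tmp (ptr Off) rN ;;
     Add (ptr Nbr) tmp rOne ;; Load tmp tmp ;; Add (ptr Stamp) (ptr Nbr) tmp ;;
     Add (ptr Queue) (ptr Stamp) rN ;; Add (ptr Mark) (ptr Queue) rN ;;
     Add (ptr Far) (ptr Mark) rN ;; Add (ptr Near) (ptr Far) rN ;; Add (ptr Count) (ptr Near) rN"

context graph_ram
begin

lemma wp_choose_boundary: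
  assumes I: "marked n V A" and c: "4 \<le> c"
    and post: "\<And>c' V'. swept 0 V' A \<Longrightarrow> c \<le> c' + 4 \<Longrightarrow> Q c' V' A"
  shows "wp choose_boundary Q c V A"
proof -
  have I': "const_regs V" "inputs A" "V rInf = 0" "V rCS = card (S' \<inter> {..<n})"
    "V rCT = card (T' \<inter> {..<n})" "V rNT = card (T \<inter> {..<n})"
    "\<forall>u<n. A Mark u = mark u \<and> A Near u = n"
    "\<forall>u<n. A Stamp u = 0 \<and> A Far u = 0 \<and> A Count u = 0"
    using I unfolding marked_def by blast+
  have int: "S' \<inter> {..<n} = S'" "T' \<inter> {..<n} = T'" "T \<inter> {..<n} = T"
    using S_subset by (auto simp: with_neighbor_in_def)
  have disj: "u \<notin> S' \<or> u \<notin> T'" for u by (auto simp: with_neighbor_in_def)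
  have sw: "swept 0 V' A"
    if "\<forall>r. r \<notin> {rTarget, rCB, rBest} \<longrightarrow> V' r = V r" "V' rBest = n"
      "V' rCB = card B" "\<forall>u<n. mark u = V' rTarget \<longleftrightarrow> u \<in> B" for V'
    using that I' unfolding swept_def const_regs_def summary_def int
    by (simp add: bot_enat_def top_enat_def flip: zero_enat_def)
  have N: "V rN = n" "V rOne = 1" "V rTwo = 2" using I' by (simp_all add: const_regs_def)
  show ?thesis
  proof (cases "V rCT < V rCS")
    case True
    then have "B = T'" using I' by (simp add: boundary_def Let_def int)
    moreover have "\<forall>u. mark u = 1 \<longleftrightarrow> u \<in> T'" using disj by (auto simp: mark_def)
    ultimately have B: "V rCT = card B" "\<forall>u<n. mark u = 1 \<longleftrightarrow> u \<in> B" using I' int by simp_all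
    show ?thesis
      unfolding choose_boundary_def using True c B
      by (intro wp_rules wp_If) (auto intro!: post sw simp: N split: if_splits)
  next
    case False
    then have "B = S'" using I' by (simp add: boundary_def Let_def int)
    moreover have "\<forall>u. mark u = 2 \<longleftrightarrow> u \<in> S'" by (auto simp: mark_def)
    ultimately have B: "V rCS = card B" "\<forall>u<n. mark u = 2 \<longleftrightarrow> u \<in> B" using I' int by simp_all
    show ?thesis
      unfolding choose_boundary_def using False c B
      by (intro wp_rules wp_If) (auto intro!: post sw simp: N split: if_splits)
  qed
qed

lemma swept_imp_combined:
  assumes "swept n V A"
  shows "combined 0 (V(rCentral := n, rFar := 0, rV := 0)) A"
proof -
  have "B \<inter> {..<n} = B" using boundary_less by auto
  with assms show ?thesis
    by (simp add: swept_def combined_def const_regs_def bot_enat_def top_enat_def flip: zero_enat_def)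
qed

definition main_cost :: nat where
  "main_cost = 40 + (\<Sum>v<n. 30 + 8 * deg v + 2) + (\<Sum>v<n. sweep_cost v + 2) + (\<Sum>v<n. 10 + 2)"

lemma wp_main:
  assumes V: "const_regs V" "inputs A" "V rInf = 0" "V rCS = 0" "V rCT = 0" "V rNT = 0"
    and A: "\<forall>u<n. A Stamp u = 0 \<and> A Far u = 0 \<and> A Count u = 0"
    and c: "main_cost \<le> c"
    and post: "\<And>c' V' A'. (if V' rInf = 0 then enat (V' rRes) else \<infinity>) = estimate E S T B \<Longrightarrow> Q c' V' A'"
  shows "wp main Q c V A"
proof -
  let ?c1 = "2 + (\<Sum>v<n. 30 + 8 * deg v + 2)"
  let ?c2 = "2 + (\<Sum>v<n. sweep_cost v + 2)"
  let ?c3 = "2 + (\<Sum>v<n. 10 + 2 :: nat)"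
  have cost: "?c1 + 4 + ?c2 + 2 + ?c3 + 20 \<le> c" using c unfolding main_cost_def by simp
  let ?Q3 = "wp finish Q"
  let ?Q2 = "wp (Move rCentral rN ;; Move rFar rZero ;; for_vertices combine_vertex ;; finish) Q"
  let ?Q1 = "wp (choose_boundary ;; for_vertices process_vertex ;;
     Move rCentral rN ;; Move rFar rZero ;; for_vertices combine_vertex ;; finish) Q"
  have 3: "wp (for_vertices combine_vertex) ?Q3 c' V' A'"
    if "swept n V0 A'" "V' = V0(rCentral := n, rFar := 0)" "?c3 + 20 \<le> c'" for c' V' V0 A'
  proof (rule wp_for_vertices[where I = combined and cost = "\<lambda>_. 10"])
    show "const_regs V'" using that by (simp add: swept_def const_regs_def)
    show "combined 0 (V'(rV := 0)) A'" using swept_imp_combined[OF that(1)] that(2) by simp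
    fix c'' V'' A'' assume "combined n V'' A''" "c' \<le> c'' + ?c3"
    with that(3) post show "wp finish Q c'' V'' A''" by (intro wp_finish) auto
  qed (use that wp_combine_vertex in \<open>auto simp: combined_def const_regs_def\<close>)
  have 2: "wp (for_vertices process_vertex) ?Q2 c' V' A'"
    if "swept 0 V' A'" "?c2 + 2 + ?c3 + 20 \<le> c'" for c' V' A'
  proof (rule wp_for_vertices[where I = swept and cost = sweep_cost])
    fix c'' V'' A'' assume sw: "swept n V'' A''" and "c' \<le> c'' + ?c2"
    then have "?c3 + 22 \<le> c''" using that(2) by simp
    moreover have "V'' rN = n" "V'' rZero = 0" using sw by (simp_all add: swept_def const_regs_def)
    ultimately show "?Q2 c'' V'' A''" using 3[OF sw] by (intro wp_Seq wp_Move) simp_all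
  qed (use that wp_process_vertex in \<open>auto simp: swept_def const_regs_def\<close>)
  have 1: "wp (for_vertices mark_vertex) ?Q1 c V A"
  proof (rule wp_for_vertices[where I = marked and cost = "\<lambda>v. 30 + 8 * deg v"])
    show "marked 0 (V(rV := 0)) A" using V A by (simp add: marked_def const_regs_def)
    fix c' V' A' assume "marked n V' A'" "c \<le> c' + ?c1"
    with cost 2 show "?Q1 c' V' A'" by (intro wp_Seq wp_choose_boundary) auto
  qed (use V cost wp_mark_vertex in \<open>auto simp: marked_def const_regs_def\<close>)
  then show ?thesis unfolding main_def by (rule wp_Seq)
qed

lemma finite_E: "finite E"
  using graph by (auto simp: simple_graph_def intro: finite_subset[of E "Pow {..<n}"])

lemma card_nbrs:
  assumes "v < n"
  shows "card (nbrs E v) = deg v"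
proof -
  have "distinct (adj ! v)" using adj assms by (simp add: adjacency_lists_def)
  then show ?thesis using assms by (simp add: nbrs_eq deg_def distinct_card)
qed

lemma nbrs_irrefl: "u \<in> nbrs E v \<Longrightarrow> u \<noteq> v"
  using graph by (fastforce simp: simple_graph_def nbrs_def)

lemma length_concat_le: "length (concat adj) \<le> 2 * card E"
proof -
  let ?arcs = "SIGMA v:{..<n}. nbrs E v"
  let ?f = "\<lambda>(v, u). ({v, u}, v < u)"
  have inj: "inj_on ?f ?arcs"
    using nbrs_irrefl by (auto intro!: inj_onI simp: doubleton_eq_iff)
  have "?f ` ?arcs \<subseteq> E \<times> UNIV" by (auto simp: nbrs_def)
  then have "card ?arcs \<le> card (E \<times> (UNIV :: bool set))"
    using finite_E by (intro card_inj_on_le[OF inj]) auto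
  moreover have "card ?arcs = (\<Sum>v<n. deg v)"
    using nbrs_less by (simp add: card_nbrs card_SigmaI finite_subset[of _ "{..<n}"] subset_iff)
  ultimately show ?thesis using off_sum[of n] off_n by (simp add: card_cartesian_product)
qed

lemma n_le_length_concat:
  assumes "\<forall>v<n. \<exists>e\<in>E. v \<in> e"
  shows "n \<le> length (concat adj)"
proof -
  have "1 \<le> deg v" if v: "v < n" for v
  proof -
    obtain e where e: "e \<in> E" "v \<in> e" using assms v by blast
    then have "card e = 2" using graph by (simp add: simple_graph_def)
    with e obtain u where "e = {v, u}" by (auto simp: card_2_iff)
    then have "nbrs E v \<noteq> {}" using e by (auto simp: nbrs_def)
    then show ?thesis using nbrs_eq[OF v] by (simp add: deg_def Suc_le_eq)
  qed
  then have "(\<Sum>v<n. 1) \<le> (\<Sum>v<n. deg v)" by (intro sum_mono) simp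
  then show ?thesis using off_sum[of n] off_n by simp
qed

lemma main_cost_le: "main_cost \<le> 200 * (card E * card B + n + card E + 1)"
proof -
  let ?M = "length (concat adj)"
  have deg: "(\<Sum>v<n. 30 + 8 * deg v + 2) = 32 * n + 8 * ?M"
    using off_sum[of n] off_n by (simp add: sum.distrib flip: sum_distrib_left)
  have "(\<Sum>v<n. sweep_cost v + 2) \<le> (\<Sum>v<n. (if v \<in> B then 40 + 60 * ?M else 0) + 6)"
    by (intro sum_mono) (simp add: sweep_cost_def)
  also have "\<dots> = card B * (40 + 60 * ?M) + 6 * n"
  proof -
    have "{..<n} \<inter> B = B" using boundary_less by auto
    then show ?thesis by (simp add: sum.distrib flip: sum.inter_restrict)
  qed
  also have "card B * (40 + 60 * ?M) \<le> 100 * (card E * card B) + 60 * (card E * card B)"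
  proof (cases "B = {}")
    case False
    then have "E \<noteq> {}" using boundary_nbrs by (fastforce simp: nbrs_def)
    then have "1 \<le> card E" using finite_E by (simp add: card_gt_0_iff Suc_le_eq)
    then have "40 + 60 * ?M \<le> 160 * card E"
      using length_concat_le by linarith
    then have "card B * (40 + 60 * ?M) \<le> card B * (160 * card E)" by (rule mult_le_mono2)
    then show ?thesis by (simp add: mult.commute)
  qed simp
  finally show ?thesis using deg length_concat_le unfolding main_cost_def by simp
qed

definition initial_arrays :: "array \<Rightarrow> nat \<Rightarrow> nat" where
  "initial_arrays a = (case a of Flag \<Rightarrow> flag | Off \<Rightarrow> off | Nbr \<Rightarrow> (\<lambda>j. concat adj ! j) | _ \<Rightarrow> (\<lambda>_. 0))"

lemma initial_memory:
  assumes "i < len a"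
  shows "mem (initial_state (input_words n S adj)) (base a + i) = initial_arrays a i"
  using assms
  by (cases a) (auto simp: initial_state_def input_words_def initial_arrays_def nth_append flag_def off_def
    simp del: upt_Suc)

definition runs :: "prog \<Rightarrow> (nat \<Rightarrow> nat) \<Rightarrow> (reg \<Rightarrow> nat) \<Rightarrow> nat \<Rightarrow> (reg \<Rightarrow> nat) \<Rightarrow> bool" where
  "runs P m f t g \<longleftrightarrow> exec w P \<lparr>regs = f, mem = m\<rparr> t \<lparr>regs = g, mem = m\<rparr>"

lemma runs_Seq: "runs P m f t g \<Longrightarrow> runs R m g u h \<Longrightarrow> runs (P ;; R) m f (t + u) h"
  unfolding runs_def by (rule exec_Seq)

lemma runs_Const: "k < 2 ^ w \<Longrightarrow> runs (Const r k) m f 1 (f(r := k))"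
  using exec_Const[of w r k "\<lparr>regs = f, mem = m\<rparr>"] by (simp add: runs_def set_reg_def)

lemma runs_Add: "f i + f j = x \<Longrightarrow> x < 2 ^ w \<Longrightarrow> runs (Add r i j) m f 1 (f(r := x))"
  using exec_Add[of w r i j "\<lparr>regs = f, mem = m\<rparr>"] by (auto simp: runs_def set_reg_def)

lemma runs_Load: "m (f i) = x \<Longrightarrow> runs (Load r i) m f 1 (f(r := x))"
  using exec_Load[of w r i "\<lparr>regs = f, mem = m\<rparr>"] by (auto simp: runs_def set_reg_def)

lemma exec_setup:
  obtains t s where "exec w setup_regs (initial_state (input_words n S adj)) t s" "t \<le> 20"
    "represents s (regs s) initial_arrays" "const_regs (regs s)"
    "regs s rInf = 0" "regs s rCS = 0" "regs s rCT = 0" "regs s rNT = 0"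
proof -
  let ?m = "mem (initial_state (input_words n S adj))"
  let ?M = "length (concat adj)"
  have s0: "initial_state (input_words n S adj) = \<lparr>regs = (\<lambda>_. 0), mem = ?m\<rparr>"
    by (simp add: initial_state_def)
  have mem0: "?m 0 = n" by (simp add: initial_state_def input_words_def)
  have "?m (base Off + n) = off n"
    using initial_memory[of n Off] by (simp add: initial_arrays_def)
  then have memM: "?m (n + 1 + n) = ?M" by (simp add: off_n)
  have small: "1 < (2::nat) ^ w" "2 < (2::nat) ^ w" using room by linarith+
  have "\<exists>g. runs setup_regs ?m (\<lambda>_. 0)
      (1 + (1 + (1 + (1 + (1 + (1 + (1 + (1 + (1 + (1 + (1 + (1 + (1 + 1))))))))))))) g
      \<and> (\<forall>a. g (ptr a) = base a) \<and> const_regs g \<and> g rInf = 0 \<and> g rCS = 0 \<and> g rCT = 0 \<and> g rNT = 0"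
    unfolding setup_regs_def
    apply (rule exI, rule conjI)
     apply (rule runs_Seq, (rule runs_Const, use room in simp
         | rule runs_Add, simp, use room in simp
         | rule runs_Load, simp add: mem0 memM[simplified]))+
     apply (rule runs_Add, simp, use room in simp)
    apply (intro conjI allI)
         apply (case_tac a; simp)
        apply (simp_all add: const_regs_def)
    done
  then obtain t g where g: "runs setup_regs ?m (\<lambda>_. 0) t g" "t \<le> 20" "\<And>a. g (ptr a) = base a"
    "const_regs g" "g rInf = 0" "g rCS = 0" "g rCT = 0" "g rNT = 0" by force
  have "exec w setup_regs (initial_state (input_words n S adj)) t \<lparr>regs = g, mem = ?m\<rparr>"
    using g(1) unfolding runs_def s0[symmetric] .
  moreover have "represents \<lparr>regs = g, mem = ?m\<rparr> g initial_arrays"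
    unfolding represents_def using initial_memory g(3) by simp
  ultimately show ?thesis
    using g by (intro that[of t "\<lparr>regs = g, mem = ?m\<rparr>"]) simp_all
qed

end

theorem theorem30:
  shows "\<exists>(P :: prog) (C :: nat) (K :: nat).
    \<forall>(n :: nat) (E :: nat set set) (S :: nat set) (adj :: nat list list) (w :: nat).
      simple_graph {..<n} E \<and> S \<subseteq> {..<n} \<and> adjacency_lists n E adj
        \<and> K * (n + card E + 1) \<le> 2 ^ w \<longrightarrow>
      (let T = {..<n} - S; m = card E; B = boundary E S T in
       \<exists>t s. exec w P (initial_state (input_words n S adj)) t s
         \<and> (B \<noteq> {} \<and> (\<forall>v<n. \<exists>e\<in>E. v \<in> e) \<longrightarrow> t \<le> C * (m * card B))
         \<and> t \<le> C * (m * card B + n + m + 1)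
         \<and> ereal_of_enat (radius_ST E S T) \<le> ereal_of_enat (result s)
         \<and> ereal_of_enat (result s) \<le> 3 / 2 * ereal_of_enat (radius_ST E S T) + 3)"
proof (intro exI allI impI, elim conjE)
  fix n w :: nat and E :: "nat set set" and S :: "nat set" and adj :: "nat list list"
  assume graph: "simple_graph {..<n} E" and S: "S \<subseteq> {..<n}" and adj: "adjacency_lists n E adj"
    and K: "50 * (n + card E + 1) \<le> 2 ^ w"
  let ?T = "{..<n} - S"
  let ?B = "boundary E S ?T"
  let ?s0 = "initial_state (input_words n S adj)"
  \<comment> \<open>The locale assumes that \<open>w\<close> is large enough, but this bound does not depend on \<open>w\<close>.\<close>
  have "graph_ram (8 * n + length (concat adj) + 40) n adj E S"
    by standard (fact less_imp_le[OF less_exp] graph S adj)+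
  then have "length (concat adj) \<le> 2 * card E" by (rule graph_ram.length_concat_le)
  with K have room: "8 * n + length (concat adj) + 40 \<le> 2 ^ w" by simp
  interpret graph_ram w n adj E S
    by standard (fact room graph S adj)+
  obtain t s where s: "exec w setup_regs ?s0 t s" "t \<le> 20"
    "represents s (regs s) initial_arrays" "const_regs (regs s)"
    "regs s rInf = 0" "regs s rCS = 0" "regs s rCT = 0" "regs s rNT = 0"
    by (rule exec_setup)
  have "wp main (\<lambda>_ V _. (if V rInf = 0 then enat (V rRes) else \<infinity>) = estimate E S ?T ?B)
      main_cost (regs s) initial_arrays"
    using s by (intro wp_main) (simp_all add: inputs_def initial_arrays_def)
  then obtain u s' V A where u: "exec w main s u s'" "u \<le> main_cost" "represents s' V A"
    "(if V rInf = 0 then enat (V rRes) else \<infinity>) = estimate E S ?T ?B"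
    using s(3) unfolding wp_def by blast
  have res: "result s' = estimate E S ?T ?B"
    using u(3,4) by (auto simp: result_def represents_def split: if_splits)
  have ex: "exec w (setup_regs ;; main) ?s0 (t + u) s'" using s(1) u(1) by (rule exec_Seq)
  have time: "t + u \<le> 220 * (card E * card ?B + n + card E + 1)"
    using s(2) u(2) main_cost_le by simp
  define x where "x = card E * card ?B"
  have fast: "t + u \<le> 1100 * (card E * card ?B)"
    if "?B \<noteq> {}" "\<forall>v<n. \<exists>e\<in>E. v \<in> e"
  proof -
    have "n \<le> 2 * card E" using n_le_length_concat[OF that(2)] length_concat_le by linarith
    moreover have "1 \<le> card ?B" using that(1) finite_boundary by (simp add: card_gt_0_iff Suc_le_eq)
    then have "card E \<le> x" unfolding x_def by simp
    moreover have "E \<noteq> {}" using that(1) boundary_nbrs by (fastforce simp: nbrs_def)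
    then have "1 \<le> card E" using finite_E by (simp add: card_gt_0_iff Suc_le_eq)
    ultimately show ?thesis using time unfolding x_def[symmetric] by simp
  qed
  have B: "?B = with_neighbor_in E S ?T \<or> ?B = with_neighbor_in E ?T S" by (rule boundary_cases)
  have "radius_ST E S ?T \<le> result s'" unfolding res using B by (intro radius_le_estimate) auto
  moreover have "ereal_of_enat (result s') \<le> 3 / 2 * ereal_of_enat (radius_ST E S ?T) + 3"
    unfolding res using B graph by (intro estimate_approximates) (auto simp: simple_graph_def)
  ultimately show "let T = {..<n} - S; m = card E; B = boundary E S T in
       \<exists>t s. exec w (setup_regs ;; main) ?s0 t s
         \<and> (B \<noteq> {} \<and> (\<forall>v<n. \<exists>e\<in>E. v \<in> e) \<longrightarrow> t \<le> 1100 * (m * card B))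
         \<and> t \<le> 1100 * (m * card B + n + m + 1)
         \<and> ereal_of_enat (radius_ST E S T) \<le> ereal_of_enat (result s)
         \<and> ereal_of_enat (result s) \<le> 3 / 2 * ereal_of_enat (radius_ST E S T) + 3"
    unfolding Let_def using ex time fast
    by (intro exI[of _ "t + u"] exI[of _ s'] conjI) auto
qed

end
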